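(* The interpretability logic $\mathbf{IL W^*}$ is modally complete: for every formula $\varphi$, if $\varphi$ is forced at every world of every $\mathbf{IL}$-model whose underlying frame satisfies both (i) for each $w$ the relation $S_w;R$ is conversely well-founded and (ii) $\forall w,x,y,y',z\,(wRxRyS_wy'Rz\rightarrow xRz)$, then $\mathbf{IL W^*}\vdash\varphi$.
   Context: Formulas are built from propositional variables and $\bot$ by $\rightarrow$, $\Box$ and the binary modality $\rhd$; $\Diamond A:=\neg\Box\neg A$. The logic $\mathbf{IL}$ is the smallest set of formulas containing all tautologies and all instances of: $\Box(A\rightarrow B)\rightarrow(\Box A\rightarrow\Box B)$; $\Box A\rightarrow\Box\Box A$; $\Box(\Box A\rightarrow A)\rightarrow\Box A$; $\Box(A\rightarrow B)\rightarrow A\rhd B$; $(A\rhd B)\wedge(B\rhd C)\rightarrow A\rhd C$; $(A\rhd C)\wedge(B\rhd C)\rightarrow A\vee B\rhd C$; $A\rhd B\rightarrow(\Diamond A\rightarrow\Diamond B)$; $\Diamond A\rhd A$; closed under modus ponens and necessitation. $\mathbf{IL W^*}$ is $\mathbf{IL}$ plus all instances of $\mathsf{W^*}$: $A\rhd B\rightarrow B\wedge\Box C\rhd B\wedge\Box C\wedge\Box\neg A$. An $\mathbf{IL}$-frame is $\langle W,R,S\rangle$ with $W$ non-empty countable, $R$ binary on $W$, $S=\{S_x\}_{x\in W}$, such that: $R$ conversely well-founded and transitive; $yS_xz\rightarrow xRy\wedge xRz$; $xRy\rightarrow yS_xy$; $xRyRz\rightarrow yS_xz$; each $S_x$ transitive.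 Forcing: $w\Vdash\Box A$ iff $A$ holds at all $R$-successors; $w\Vdash A\rhd B$ iff for every $u$ with $wRu$, $u\Vdash A$ there is $v$ with $uS_wv$, $v\Vdash B$. $x(S_w;R)y$ means $\exists t\,(xS_wt\wedge tRy)$; a relation is conversely well-founded if every non-empty subset has a maximal element w.r.t. it. *)

theory Defs
  imports "HOL-Library.Countable_Set"
begin

datatype form =
    Var nat
  | Bot  ("\<^bold>\<bottom>")
  | Imp form form  (infixr "\<^bold>\<rightarrow>" 53)
  | Box form  ("\<^bold>\<box> _" [80] 80)
  | Rhd form form  (infix "\<^bold>\<rhd>" 55)

abbreviation Neg :: "form \<Rightarrow> form"  ("\<^bold>\<not> _" [80] 80)
  where "\<^bold>\<not> A \<equiv> A \<^bold>\<rightarrow> \<^bold>\<bottom>"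

abbreviation Or :: "form \<Rightarrow> form \<Rightarrow> form"  (infixr "\<^bold>\<or>" 60)
  where "A \<^bold>\<or> B \<equiv> \<^bold>\<not> A \<^bold>\<rightarrow> B"

abbreviation And :: "form \<Rightarrow> form \<Rightarrow> form"  (infixr "\<^bold>\<and>" 65)
  where "A \<^bold>\<and> B \<equiv> \<^bold>\<not> (A \<^bold>\<rightarrow> \<^bold>\<not> B)"

abbreviation Dia :: "form \<Rightarrow> form"  ("\<^bold>\<diamond> _" [80] 80)
  where "\<^bold>\<diamond> A \<equiv> \<^bold>\<not> \<^bold>\<box> \<^bold>\<not> A"

text \<open>Boolean evaluation: \<open>e\<close> assigns truth values to the variables and to the
  formulas whose main connective is modal, the latter being treated as atoms.\<close>

fun bool_eval :: "(form \<Rightarrow> bool) \<Rightarrow> form \<Rightarrow> bool" where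
  "bool_eval e \<^bold>\<bottom> \<longleftrightarrow> False"
| "bool_eval e (A \<^bold>\<rightarrow> B) \<longleftrightarrow> (bool_eval e A \<longrightarrow> bool_eval e B)"
| "bool_eval e (Var p) \<longleftrightarrow> e (Var p)"
| "bool_eval e (\<^bold>\<box> A) \<longleftrightarrow> e (\<^bold>\<box> A)"
| "bool_eval e (A \<^bold>\<rhd> B) \<longleftrightarrow> e (A \<^bold>\<rhd> B)"

definition tautology :: "form \<Rightarrow> bool"
  where "tautology A \<longleftrightarrow> (\<forall>e. bool_eval e A)"

text \<open>\<open>IL_plus X\<close> is \<open>IL\<close> extended by the axioms in \<open>X\<close>. The rules apply to
  the new axioms too.\<close>

inductive_set IL_plus :: "form set \<Rightarrow> form set" for X :: "form set" where
  extra: "A \<in> X \<Longrightarrow> A \<in> IL_plus X"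
| taut: "tautology A \<Longrightarrow> A \<in> IL_plus X"
| L1: "\<^bold>\<box> (A \<^bold>\<rightarrow> B) \<^bold>\<rightarrow> (\<^bold>\<box> A \<^bold>\<rightarrow> \<^bold>\<box> B) \<in> IL_plus X"
| L2: "\<^bold>\<box> A \<^bold>\<rightarrow> \<^bold>\<box> \<^bold>\<box> A \<in> IL_plus X"
| L3: "\<^bold>\<box> (\<^bold>\<box> A \<^bold>\<rightarrow> A) \<^bold>\<rightarrow> \<^bold>\<box> A \<in> IL_plus X"
| J1: "\<^bold>\<box> (A \<^bold>\<rightarrow> B) \<^bold>\<rightarrow> (A \<^bold>\<rhd> B) \<in> IL_plus X"
| J2: "((A \<^bold>\<rhd> B) \<^bold>\<and> (B \<^bold>\<rhd> C)) \<^bold>\<rightarrow> (A \<^bold>\<rhd> C) \<in> IL_plus X"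
| J3: "((A \<^bold>\<rhd> C) \<^bold>\<and> (B \<^bold>\<rhd> C)) \<^bold>\<rightarrow> ((A \<^bold>\<or> B) \<^bold>\<rhd> C) \<in> IL_plus X"
| J4: "(A \<^bold>\<rhd> B) \<^bold>\<rightarrow> (\<^bold>\<diamond> A \<^bold>\<rightarrow> \<^bold>\<diamond> B) \<in> IL_plus X"
| J5: "(\<^bold>\<diamond> A) \<^bold>\<rhd> A \<in> IL_plus X"
| mp: "A \<^bold>\<rightarrow> B \<in> IL_plus X \<Longrightarrow> A \<in> IL_plus X \<Longrightarrow> B \<in> IL_plus X"
| nec: "A \<in> IL_plus X \<Longrightarrow> \<^bold>\<box> A \<in> IL_plus X"

definition IL :: "form set"
  where "IL = IL_plus {}"

definition W_star :: "form set"
  where "W_star =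
    {(A \<^bold>\<rhd> B) \<^bold>\<rightarrow> ((B \<^bold>\<and> \<^bold>\<box> C) \<^bold>\<rhd> (B \<^bold>\<and> \<^bold>\<box> C \<^bold>\<and> \<^bold>\<box> \<^bold>\<not> A)) | A B C. True}"

definition ILW_star :: "form set"
  where "ILW_star = IL_plus W_star"

text \<open>Maximality is strict: a maximal element of \<open>X\<close> has no \<open>r\<close>-successor in \<open>X\<close>,
  itself included.\<close>

definition conv_wf_on :: "'w set \<Rightarrow> 'w rel \<Rightarrow> bool"
  where "conv_wf_on W r \<longleftrightarrow>
    (\<forall>X \<subseteq> W. X \<noteq> {} \<longrightarrow> (\<exists>m \<in> X. \<forall>y \<in> X. (m, y) \<notin> r))"

text \<open>\<open>(y, z) \<in> S x\<close> stands for \<open>y S\<^sub>x z\<close>. Only the values \<open>S x\<close> for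
  \<open>x \<in> W\<close> matter.\<close>

locale IL_frame =
  fixes W :: "'w set" and R :: "'w rel" and S :: "'w \<Rightarrow> 'w rel"
  assumes nonempty: "W \<noteq> {}"
    and countable: "countable W"
    and R_on: "R \<subseteq> W \<times> W"
    and R_conv_wf: "conv_wf_on W R"
    and R_trans: "trans R"
    and S_sub: "\<And>x y z. x \<in> W \<Longrightarrow> (y, z) \<in> S x \<Longrightarrow> (x, y) \<in> R \<and> (x, z) \<in> R"
    and S_refl: "\<And>x y. (x, y) \<in> R \<Longrightarrow> (y, y) \<in> S x"
    and R_in_S: "\<And>x y z. (x, y) \<in> R \<Longrightarrow> (y, z) \<in> R \<Longrightarrow> (y, z) \<in> S x"
    and S_trans: "\<And>x. x \<in> W \<Longrightarrow> trans (S x)"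

locale ILW_star_frame = IL_frame +
  assumes SR_conv_wf: "\<And>w. w \<in> W \<Longrightarrow> conv_wf_on W (S w O R)"
    and M0: "\<And>w x y y' z. (w, x) \<in> R \<Longrightarrow> (x, y) \<in> R \<Longrightarrow> (y, y') \<in> S w \<Longrightarrow> (y', z) \<in> R
      \<Longrightarrow> (x, z) \<in> R"

fun forces :: "'w rel \<Rightarrow> ('w \<Rightarrow> 'w rel) \<Rightarrow> ('w \<Rightarrow> nat \<Rightarrow> bool) \<Rightarrow> 'w \<Rightarrow> form \<Rightarrow> bool" where
  "forces R S V w (Var p) \<longleftrightarrow> V w p"
| "forces R S V w \<^bold>\<bottom> \<longleftrightarrow> False"
| "forces R S V w (A \<^bold>\<rightarrow> B) \<longleftrightarrow> (forces R S V w A \<longrightarrow> forces R S V w B)"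
| "forces R S V w (\<^bold>\<box> A) \<longleftrightarrow> (\<forall>u. (w, u) \<in> R \<longrightarrow> forces R S V u A)"
| "forces R S V w (A \<^bold>\<rhd> B) \<longleftrightarrow>
    (\<forall>u. (w, u) \<in> R \<and> forces R S V u A \<longrightarrow> (\<exists>v. (u, v) \<in> S w \<and> forces R S V v B))"

text \<open>Validity in all models whose worlds are taken from the type \<open>'w\<close>.\<close>

definition ILW_star_valid :: "'w itself \<Rightarrow> form \<Rightarrow> bool"
  where "ILW_star_valid (_ :: 'w itself) A \<longleftrightarrow>
    (\<forall>(W :: 'w set) R S V. ILW_star_frame W R S \<longrightarrow> (\<forall>w \<in> W. forces R S V w A))"

text \<open>HOL cannot quantify over types inside a formula. As frames are countable, nothing is
  lost by taking the worlds among the natural numbers: validity over them implies validity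
  over every type.\<close>

lemma map_prod_image_iff:
  assumes r: "r \<subseteq> W \<times> W" and inj: "inj_on f W" and x: "x \<in> W"
  shows "(f x, n) \<in> map_prod f f ` r \<longleftrightarrow> (\<exists>u. (x, u) \<in> r \<and> n = f u)"
proof
  assume "(f x, n) \<in> map_prod f f ` r"
  then obtain x' u where *: "(x', u) \<in> r" "f x = f x'" "n = f u" by auto
  then have "x = x'" using r x by (auto intro: inj_onD[OF inj])
  then show "\<exists>u. (x, u) \<in> r \<and> n = f u" using * by blast
qed force

lemma forces_iso:
  assumes fr: "IL_frame W R S" and inj: "inj_on f W" and w: "w \<in> W"
  defines "g \<equiv> the_inv_into W f"
  shows "forces (map_prod f f ` R) (\<lambda>n. map_prod f f ` S (g n)) (\<lambda>n. V (g n)) (f w) A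
    \<longleftrightarrow> forces R S V w A"
  using w
proof (induction A arbitrary: w)
  case (Var p)
  then show ?case by (simp add: g_def the_inv_into_f_f[OF inj])
next
  case Bot
  show ?case by simp
next
  case (Imp A B)
  then show ?case by simp
next
  case (Box A)
  interpret IL_frame W R S by (rule fr)
  have "(f w, n) \<in> map_prod f f ` R \<longleftrightarrow> (\<exists>u. (w, u) \<in> R \<and> n = f u)" for n
    by (rule map_prod_image_iff[OF R_on inj Box.prems])
  moreover have "u \<in> W" if "(w, u) \<in> R" for u using that R_on by auto
  ultimately show ?case using Box.IH by auto
next
  case (Rhd A B)
  interpret IL_frame W R S by (rule fr)
  have g: "g (f w) = w" using Rhd.prems by (simp add: g_def the_inv_into_f_f[OF inj])
  have R: "(f w, n) \<in> map_prod f f ` R \<longleftrightarrow> (\<exists>u. (w, u) \<in> R \<and> n = f u)" for n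
    by (rule map_prod_image_iff[OF R_on inj Rhd.prems])
  have RW: "u \<in> W" if "(w, u) \<in> R" for u using that R_on by auto
  have SW: "u \<in> W \<and> v \<in> W" if "(u, v) \<in> S w" for u v
    using S_sub[OF Rhd.prems that] RW by auto
  have S: "(f u, n) \<in> map_prod f f ` S w \<longleftrightarrow> (\<exists>v. (u, v) \<in> S w \<and> n = f v)" if "u \<in> W" for u n
  proof (rule map_prod_image_iff[OF _ inj that])
    show "S w \<subseteq> W \<times> W" using SW by auto
  qed
  define F where
    "F = forces (map_prod f f ` R) (\<lambda>n. map_prod f f ` S (g n)) (\<lambda>n. V (g n))"
  have IH: "F (f u) A \<longleftrightarrow> forces R S V u A" "F (f u) B \<longleftrightarrow> forces R S V u B"
    if "u \<in> W" for u
    using Rhd.IH that by (simp_all add: F_def)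
  have witness: "(\<exists>n. (f u, n) \<in> map_prod f f ` S w \<and> F n B)
      \<longleftrightarrow> (\<exists>v. (u, v) \<in> S w \<and> forces R S V v B)" if "u \<in> W" for u
    unfolding S[OF that] using IH(2) SW by metis
  have "F (f w) (A \<^bold>\<rhd> B) \<longleftrightarrow>
      (\<forall>n. (f w, n) \<in> map_prod f f ` R \<and> F n A \<longrightarrow>
        (\<exists>k. (n, k) \<in> map_prod f f ` S w \<and> F k B))"
    by (simp only: F_def forces.simps g)
  also have "\<dots> \<longleftrightarrow> (\<forall>u. (w, u) \<in> R \<and> F (f u) A \<longrightarrow>
      (\<exists>k. (f u, k) \<in> map_prod f f ` S w \<and> F k B))"
    unfolding R by metis
  also have "\<dots> \<longleftrightarrow> forces R S V w (A \<^bold>\<rhd> B)"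
    unfolding forces.simps using witness IH(1) RW by metis
  finally show ?case unfolding F_def .
qed

lemma conv_wf_on_iso:
  assumes c: "conv_wf_on W r" and r: "r \<subseteq> W \<times> W" and inj: "inj_on f W"
  shows "conv_wf_on (f ` W) (map_prod f f ` r)"
  unfolding conv_wf_on_def
proof (intro allI impI)
  fix X assume X: "X \<subseteq> f ` W" "X \<noteq> {}"
  let ?Y = "{w \<in> W. f w \<in> X}"
  have "?Y \<subseteq> W" "?Y \<noteq> {}" using X by auto
  then obtain m where m: "m \<in> ?Y" "\<forall>y \<in> ?Y. (m, y) \<notin> r"
    using c[unfolded conv_wf_on_def, rule_format, of ?Y] by auto
  have "(f m, y) \<notin> map_prod f f ` r" if "y \<in> X" for y
  proof
    assume "(f m, y) \<in> map_prod f f ` r"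
    then obtain u where "(m, u) \<in> r" "y = f u"
      using map_prod_image_iff[OF r inj, of m y] m(1) by auto
    moreover have "u \<in> ?Y" using calculation r that by auto
    ultimately show False using m(2) by simp
  qed
  then show "\<exists>m \<in> X. \<forall>y \<in> X. (m, y) \<notin> map_prod f f ` r"
    using m(1) by (intro bexI[of _ "f m"] ballI) simp_all
qed

lemma ILW_star_frame_iso:
  assumes fr: "ILW_star_frame W R S" and inj: "inj_on f W"
    and countable': "countable (f ` W)"
  defines "g \<equiv> the_inv_into W f"
  shows "ILW_star_frame (f ` W) (map_prod f f ` R) (\<lambda>n. map_prod f f ` S (g n))"
proof -
  interpret ILW_star_frame W R S by (rule fr)
  have g: "g (f w) = w" if "w \<in> W" for w
    using that by (simp add: g_def the_inv_into_f_f[OF inj])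
  have RW: "x \<in> W" "y \<in> W" if "(x, y) \<in> R" for x y using that R_on by auto
  have SW: "y \<in> W" "z \<in> W" if "x \<in> W" "(y, z) \<in> S x" for x y z
    using S_sub[OF that] RW by auto
  have fR: "(f x, f y) \<in> map_prod f f ` R \<longleftrightarrow> (x, y) \<in> R" if "x \<in> W" "y \<in> W" for x y
    unfolding map_prod_image_iff[OF R_on inj that(1)] using RW(2) that(2) inj_onD[OF inj] by metis
  have fS: "(f y, f z) \<in> map_prod f f ` S x \<longleftrightarrow> (y, z) \<in> S x"
    if "x \<in> W" "y \<in> W" "z \<in> W" for x y z
  proof -
    have "S x \<subseteq> W \<times> W" using SW[OF that(1)] by auto
    from map_prod_image_iff[OF this inj that(2)] show ?thesis
      using SW(2)[OF that(1)] that(3) inj_onD[OF inj] by metis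
  qed
  have RfE: "\<exists>x y. x \<in> W \<and> y \<in> W \<and> (x, y) \<in> R \<and> a = f x \<and> b = f y"
    if "(a, b) \<in> map_prod f f ` R" for a b
  proof -
    from that obtain x y where "(x, y) \<in> R" "a = f x" "b = f y" by auto
    then show ?thesis using RW by metis
  qed
  have SfE: "\<exists>y z. y \<in> W \<and> z \<in> W \<and> (y, z) \<in> S x \<and> a = f y \<and> b = f z"
    if "x \<in> W" "(a, b) \<in> map_prod f f ` S x" for x a b
  proof -
    from that(2) obtain y z where "(y, z) \<in> S x" "a = f y" "b = f z" by auto
    then show ?thesis using SW[OF that(1)] by metis
  qed
  have eq: "map_prod f f ` S w O map_prod f f ` R = map_prod f f ` (S w O R)" if w: "w \<in> W" for w
  proof
    show "map_prod f f ` S w O map_prod f f ` R \<subseteq> map_prod f f ` (S w O R)"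
    proof (rule subrelI)
      fix a b assume "(a, b) \<in> map_prod f f ` S w O map_prod f f ` R"
      then obtain t where "(a, t) \<in> map_prod f f ` S w" "(t, b) \<in> map_prod f f ` R"
        by (rule relcompEpair)
      then obtain p q p' q' where *: "(p, q) \<in> S w" "(p', q') \<in> R" "a = f p" "t = f q" "t = f p'"
          "b = f q'" "q \<in> W" "p' \<in> W"
        using SfE[OF w] RfE by metis
      then have "q = p'" using inj_onD[OF inj] by metis
      then have "(p, q') \<in> S w O R" using * by auto
      then have "map_prod f f (p, q') \<in> map_prod f f ` (S w O R)" by (rule imageI)
      then show "(a, b) \<in> map_prod f f ` (S w O R)" using * by simp
    qed
    show "map_prod f f ` (S w O R) \<subseteq> map_prod f f ` S w O map_prod f f ` R"
      by (auto intro!: relcompI)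
  qed
  define R' where "R' = map_prod f f ` R"
  define S' where "S' = (\<lambda>n. map_prod f f ` S (g n))"
  have S': "S' (f w) = map_prod f f ` S w" if "w \<in> W" for w
    using that by (simp add: S'_def g)
  note fR = fR[folded R'_def] and RfE = RfE[folded R'_def]
  have fS: "(f y, f z) \<in> S' (f x) \<longleftrightarrow> (y, z) \<in> S x"
    if "x \<in> W" "y \<in> W" "z \<in> W" for x y z
    unfolding S'[OF that(1)] by (rule fS[OF that])
  have SfE: "\<exists>y z. y \<in> W \<and> z \<in> W \<and> (y, z) \<in> S x \<and> a = f y \<and> b = f z"
    if "x \<in> W" "(a, b) \<in> S' (f x)" for x a b
    using SfE[OF that(1)] that unfolding S'[OF that(1)] by blast
  have "ILW_star_frame (f ` W) R' S'"
  proof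
    show "f ` W \<noteq> {}" using nonempty by simp
    show "countable (f ` W)" by (rule countable')
    show "R' \<subseteq> f ` W \<times> f ` W" using R_on by (auto simp: R'_def)
    show "conv_wf_on (f ` W) R'"
      unfolding R'_def by (rule conv_wf_on_iso[OF R_conv_wf R_on inj])
    show "trans R'"
    proof (rule transI)
      fix a b c assume ab: "(a, b) \<in> R'" and bc: "(b, c) \<in> R'"
      obtain x y where 1: "x \<in> W" "y \<in> W" "(x, y) \<in> R" "a = f x" "b = f y"
        using RfE[OF ab] by blast
      obtain z where 2: "z \<in> W" "(y, z) \<in> R" "c = f z"
        using RfE[OF bc] bc fR 1 by metis
      have "(x, z) \<in> R" using R_trans 1(3) 2(2) by (rule transD)
      then show "(a, c) \<in> R'" using fR 1 2 by simp
    qed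
  next
    fix x y z
    assume "x \<in> f ` W" and yz: "(y, z) \<in> S' x"
    then obtain x' where x': "x' \<in> W" "x = f x'" by blast
    obtain y' z' where "y' \<in> W" "z' \<in> W" "(y', z') \<in> S x'" "y = f y'" "z = f z'"
      using SfE[OF x'(1)] yz x'(2) by blast
    then show "(x, y) \<in> R' \<and> (x, z) \<in> R'"
      using S_sub[OF x'(1)] fR x' by simp
  next
    fix x y assume "(x, y) \<in> R'"
    from RfE[OF this] show "(y, y) \<in> S' x"
      using S_refl fS by metis
  next
    fix x y z assume xy: "(x, y) \<in> R'" and yz: "(y, z) \<in> R'"
    obtain x0 y0 where 1: "x0 \<in> W" "y0 \<in> W" "(x0, y0) \<in> R" "x = f x0" "y = f y0"
      using RfE[OF xy] by blast
    obtain z0 where 2: "z0 \<in> W" "(y0, z0) \<in> R" "z = f z0"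
      using RfE[OF yz] yz fR 1 by metis
    show "(y, z) \<in> S' x" using R_in_S[OF 1(3) 2(2)] fS 1 2 by simp
  next
    fix x assume "x \<in> f ` W"
    then obtain x' where x': "x' \<in> W" "x = f x'" by blast
    show "trans (S' x)"
    proof (rule transI)
      fix a b c assume ab: "(a, b) \<in> S' x" and bc: "(b, c) \<in> S' x"
      obtain p q where 1: "p \<in> W" "q \<in> W" "(p, q) \<in> S x'" "a = f p" "b = f q"
        using SfE[OF x'(1)] ab x'(2) by blast
      obtain r where 2: "r \<in> W" "(q, r) \<in> S x'" "c = f r"
        using SfE[OF x'(1)] bc x' fS 1 by metis
      have "(p, r) \<in> S x'" using S_trans[OF x'(1)] 1(3) 2(2) by (rule transD)
      then show "(a, c) \<in> S' x" using fS 1 2 x' by simp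
    qed
  next
    fix w assume "w \<in> f ` W"
    then obtain w' where w': "w' \<in> W" "w = f w'" by blast
    have "S w' O R \<subseteq> W \<times> W"
    proof (rule subrelI)
      fix a b assume "(a, b) \<in> S w' O R"
      then obtain t where "(a, t) \<in> S w'" "(t, b) \<in> R" by blast
      then show "(a, b) \<in> W \<times> W" using SW(1)[OF w'(1)] RW(2) by simp
    qed
    from conv_wf_on_iso[OF SR_conv_wf[OF w'(1)] this inj]
    show "conv_wf_on (f ` W) (S' w O R')"
      by (simp only: eq[OF w'(1), symmetric] w'(2) S'[OF w'(1)] R'_def)
  next
    fix w x y y' z
    assume a: "(w, x) \<in> R'" "(x, y) \<in> R'" "(y, y') \<in> S' w" "(y', z) \<in> R'"
    obtain w0 x0 where 1: "w0 \<in> W" "x0 \<in> W" "w = f w0" "x = f x0" "(w0, x0) \<in> R"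
      using RfE[OF a(1)] by blast
    obtain y0 where 2: "y0 \<in> W" "y = f y0" "(x0, y0) \<in> R"
      using RfE[OF a(2)] a(2) fR 1 by metis
    obtain y1 where 3: "y1 \<in> W" "y' = f y1" "(y0, y1) \<in> S w0"
      using SfE[OF 1(1)] a(3) fS 1 2 by metis
    obtain z0 where 4: "z0 \<in> W" "z = f z0" "(y1, z0) \<in> R"
      using RfE[OF a(4)] a(4) fR 3 by metis
    show "(x, z) \<in> R'" using M0[OF 1(5) 2(3) 3(3) 4(3)] fR 1 4 by simp
  qed
  then show ?thesis unfolding R'_def S'_def .
qed

lemma ILW_star_valid_nat_imp:
  assumes "ILW_star_valid TYPE(nat) A"
  shows "ILW_star_valid TYPE('w) A"
  unfolding ILW_star_valid_def
proof (intro allI impI ballI)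
  fix W :: "'w set" and R S V w
  assume fr: "ILW_star_frame W R S" and w: "w \<in> W"
  interpret ILW_star_frame W R S by (rule fr)
  let ?f = "to_nat_on W"
  have inj: "inj_on ?f W" using countable by (rule inj_on_to_nat_on)
  let ?g = "the_inv_into W ?f"
  let ?R = "map_prod ?f ?f ` R" and ?S = "\<lambda>n. map_prod ?f ?f ` S (?g n)"
  have "ILW_star_frame (?f ` W) ?R ?S"
    by (rule ILW_star_frame_iso[OF fr inj]) simp
  then have "\<forall>n \<in> ?f ` W. forces ?R ?S (\<lambda>n. V (?g n)) n A"
    using assms unfolding ILW_star_valid_def by blast
  then have "forces ?R ?S (\<lambda>n. V (?g n)) (?f w) A" using w by (rule bspec[OF _ imageI])
  then show "forces R S V w A" by (rule forces_iso[OF IL_frame_axioms inj w, THEN iffD1])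
qed

end

theory Submission
  imports Defs
begin

text \<open>
  The worlds of the countermodel are nodes of a tree labelled with maximal consistent sets. A node
  has two ancestors attached: its tree parent \<open>t\<close>, whose box formulas it keeps, and a node \<open>p\<close> at or
  above \<open>t\<close> in the direction of the root, over which it is critical. Put \<open>x R z\<close> if \<open>x\<close> is an
  ancestor of the \<open>p\<close> of \<open>z\<close>. A successor of a node is then a successor of all its tree ancestors, so
  that the frame condition \<open>w R x R y S\<^sub>w y' R z \<Longrightarrow> x R z\<close> only requires that \<open>x\<close> be a tree ancestor
  of \<open>y'\<close>. Given \<open>w R y\<close> with \<open>A \<rhd> B\<close> in \<open>w\<close> and \<open>A\<close> in \<open>y\<close>, such a \<open>y'\<close> is placed beside \<open>y\<close> if the
  \<open>p\<close> of \<open>y\<close> is \<open>w\<close>, and otherwise below the last \<open>x\<close> with \<open>w R x R y\<close>. It is chosen critical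
  relative to the box formulas of this \<open>x\<close> (in the first case, of \<open>y\<close>'s own label) and to \<open>\<box>\<not>A\<close>;
  it exists by the principles \<open>\<diamond>A \<and> \<box>C \<rhd> B \<and> \<box>C\<close> and \<open>A \<rhd> B \<and> \<box>\<not>A\<close>, which \<open>W\<^sup>*\<close> yields from
  \<open>A \<rhd> B\<close>. On the tree, \<open>S\<^sub>w\<close> is taken as large as these requirements permit, which makes it
  transitive at once. The formulas \<open>\<box>\<not>A\<close> kept along \<open>S\<^sub>w ; R\<close> grow strictly within a finite set,
  whence converse well-foundedness. Finally a countable set of nodes containing the needed
  witnesses is cut out.
\<close>

section \<open>Maximal consistent sets\<close>

text \<open>Necessitation enters only through the theorems in \<open>ax\<close>, never applied to
  hypotheses; hence the deduction theorem \<open>ded_insert\<close>.\<close>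

inductive_set ded :: "form set \<Rightarrow> form set" for S :: "form set" where
  hyp: "A \<in> S \<Longrightarrow> A \<in> ded S"
| ax: "A \<in> ILW_star \<Longrightarrow> A \<in> ded S"
| mp: "A \<^bold>\<rightarrow> B \<in> ded S \<Longrightarrow> A \<in> ded S \<Longrightarrow> B \<in> ded S"

text \<open>With bottom for \<open>B\<close>, the equivalence says that exactly one of a formula and
  its negation is in \<open>G\<close>.\<close>

definition mcs :: "form set \<Rightarrow> bool" where
  "mcs G \<longleftrightarrow> ILW_star \<subseteq> G \<and> \<^bold>\<bottom> \<notin> G \<and> (\<forall>A B. A \<^bold>\<rightarrow> B \<in> G \<longleftrightarrow> (A \<in> G \<longrightarrow> B \<in> G))"

lemma mcs_Bot [simp]: "mcs G \<Longrightarrow> \<^bold>\<bottom> \<notin> G"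
  by (simp add: mcs_def)

lemma mcs_Imp [simp]: "mcs G \<Longrightarrow> A \<^bold>\<rightarrow> B \<in> G \<longleftrightarrow> (A \<in> G \<longrightarrow> B \<in> G)"
  by (simp add: mcs_def)

lemma mcs_thm: "mcs G \<Longrightarrow> A \<in> ILW_star \<Longrightarrow> A \<in> G"
  unfolding mcs_def by blast

lemma ded_taut: "tautology A \<Longrightarrow> A \<in> ded S"
  by (intro ded.ax) (simp add: ILW_star_def IL_plus.taut)

lemma ded_insert: "B \<in> ded (insert A S) \<Longrightarrow> A \<^bold>\<rightarrow> B \<in> ded S"
proof (induction rule: ded.induct)
  case (hyp B)
  have "A \<^bold>\<rightarrow> A \<in> ded S" "B \<^bold>\<rightarrow> (A \<^bold>\<rightarrow> B) \<in> ded S"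
    by (auto intro!: ded_taut simp: tautology_def)
  then show ?case using hyp by (auto intro: ded.intros)
next
  case (ax B)
  have "B \<^bold>\<rightarrow> (A \<^bold>\<rightarrow> B) \<in> ded S"
    by (auto intro!: ded_taut simp: tautology_def)
  then show ?case using ax by (auto intro: ded.intros)
next
  case (mp B C)
  have "(A \<^bold>\<rightarrow> (B \<^bold>\<rightarrow> C)) \<^bold>\<rightarrow> ((A \<^bold>\<rightarrow> B) \<^bold>\<rightarrow> (A \<^bold>\<rightarrow> C)) \<in> ded S"
    by (auto intro!: ded_taut simp: tautology_def)
  then show ?case using mp by (blast intro: ded.mp)
qed

lemma ded_mono: "A \<in> ded S \<Longrightarrow> S \<subseteq> T \<Longrightarrow> A \<in> ded T"
  by (induction rule: ded.induct) (auto intro: ded.intros)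

lemma ded_Union_chain:
  assumes "A \<in> ded (\<Union>C)" "C \<noteq> {}" "subset.chain X C"
  shows "\<exists>S \<in> C. A \<in> ded S"
  using assms(1)
proof (induction rule: ded.induct)
  case (mp A B)
  then obtain S T where *: "S \<in> C" "A \<^bold>\<rightarrow> B \<in> ded S" "T \<in> C" "A \<in> ded T" by auto
  then have "S \<subseteq> T \<or> T \<subseteq> S" using assms(3) by (auto simp: subset.chain_def)
  then show ?case
  proof
    assume "S \<subseteq> T"
    then show ?thesis using * ded_mono ded.mp by blast
  next
    assume "T \<subseteq> S"
    then show ?thesis using * ded_mono ded.mp by blast
  qed
qed (use assms(2) in \<open>auto intro: ded.intros\<close>)

lemma Lindenbaum:
  assumes "\<^bold>\<bottom> \<notin> ded S"
  obtains G where "mcs G" "S \<subseteq> G"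
proof -
  let ?X = "{T. S \<subseteq> T \<and> \<^bold>\<bottom> \<notin> ded T}"
  have "\<exists>M\<in>?X. \<forall>T\<in>?X. M \<subseteq> T \<longrightarrow> T = M"
  proof (rule subset_Zorn_nonempty)
    show "?X \<noteq> {}" using assms by auto
  next
    fix C assume C: "C \<noteq> {}" "subset.chain ?X C"
    then have "\<forall>T\<in>C. S \<subseteq> T \<and> \<^bold>\<bottom> \<notin> ded T" by (auto simp: subset.chain_def)
    then show "\<Union>C \<in> ?X" using C ded_Union_chain[of "\<^bold>\<bottom>" C ?X] by auto
  qed
  then obtain M where M: "S \<subseteq> M" "\<^bold>\<bottom> \<notin> ded M"
    and max: "\<And>T. M \<subseteq> T \<Longrightarrow> \<^bold>\<bottom> \<notin> ded T \<Longrightarrow> T = M" by auto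
  have closed: "A \<in> M" if "A \<in> ded M" for A
  proof -
    have "\<^bold>\<bottom> \<notin> ded (insert A M)"
      using ded_insert[of "\<^bold>\<bottom>" A M] that M(2) ded.mp by blast
    then show ?thesis using max[of "insert A M"] by auto
  qed
  have neg: "\<^bold>\<not> A \<in> M" if "A \<notin> M" for A
  proof -
    have "\<^bold>\<bottom> \<in> ded (insert A M)" using max[of "insert A M"] that by auto
    then show ?thesis using closed ded_insert by blast
  qed
  have "mcs M"
    unfolding mcs_def
  proof (intro conjI allI)
    show "ILW_star \<subseteq> M" using closed by (auto intro: ded.ax)
    show "\<^bold>\<bottom> \<notin> M" using M(2) ded.hyp by blast
  next
    fix A B
    have t: "\<^bold>\<not> A \<^bold>\<rightarrow> (A \<^bold>\<rightarrow> B) \<in> ded M" "B \<^bold>\<rightarrow> (A \<^bold>\<rightarrow> B) \<in> ded M"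
      by (auto intro!: ded_taut simp: tautology_def)
    show "A \<^bold>\<rightarrow> B \<in> M \<longleftrightarrow> (A \<in> M \<longrightarrow> B \<in> M)"
      using closed neg[of A] t ded.hyp ded.mp by metis
  qed
  then show ?thesis using M(1) that by blast
qed

text \<open>Replaces Hilbert-style derivations by reasoning in an arbitrary maximal consistent
  set.\<close>

lemma thm_if_all_mcs:
  assumes "\<And>G. mcs G \<Longrightarrow> A \<in> G"
  shows "A \<in> ILW_star"
proof (rule ccontr)
  assume A: "A \<notin> ILW_star"
  have *: "B \<in> ILW_star" if "B \<in> ded {}" for B
    using that by induction (auto simp: ILW_star_def intro: IL_plus.mp)
  have "\<^bold>\<bottom> \<notin> ded {\<^bold>\<not> A}"
  proof
    assume "\<^bold>\<bottom> \<in> ded {\<^bold>\<not> A}"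
    then have "\<^bold>\<not> \<^bold>\<not> A \<in> ded {}" by (rule ded_insert)
    moreover have "\<^bold>\<not> \<^bold>\<not> A \<^bold>\<rightarrow> A \<in> ded {}" by (rule ded_taut) (simp add: tautology_def)
    ultimately show False using * A ded.mp by blast
  qed
  then show False using Lindenbaum[of "{\<^bold>\<not> A}"] assms by (metis insert_subset mcs_Bot mcs_Imp)
qed

lemma mcs_box_mono:
  assumes "mcs w" "\<^bold>\<box> A \<in> w" "\<And>G. mcs G \<Longrightarrow> A \<in> G \<Longrightarrow> B \<in> G"
  shows "\<^bold>\<box> B \<in> w"
proof -
  have "A \<^bold>\<rightarrow> B \<in> ILW_star" by (rule thm_if_all_mcs) (simp add: assms(3))
  then have "\<^bold>\<box> (A \<^bold>\<rightarrow> B) \<in> ILW_star" unfolding ILW_star_def by (rule IL_plus.nec)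
  moreover have "\<^bold>\<box> (A \<^bold>\<rightarrow> B) \<^bold>\<rightarrow> (\<^bold>\<box> A \<^bold>\<rightarrow> \<^bold>\<box> B) \<in> ILW_star"
    by (simp add: ILW_star_def IL_plus.L1)
  ultimately show ?thesis using assms(1,2) mcs_thm by (metis mcs_Imp)
qed

lemma mcs_box_thm:
  assumes "mcs w" "\<And>G. mcs G \<Longrightarrow> A \<in> G"
  shows "\<^bold>\<box> A \<in> w"
  using mcs_thm[OF assms(1)] thm_if_all_mcs[OF assms(2)] IL_plus.nec unfolding ILW_star_def
  by blast

lemma mcs_box_conj:
  assumes "mcs w" "\<^bold>\<box> A \<in> w" "\<^bold>\<box> B \<in> w"
  shows "\<^bold>\<box> (A \<^bold>\<and> B) \<in> w"
proof -
  have "\<^bold>\<box> (B \<^bold>\<rightarrow> A \<^bold>\<and> B) \<in> w"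
    by (rule mcs_box_mono[OF assms(1,2)]) simp
  moreover have "\<^bold>\<box> (B \<^bold>\<rightarrow> A \<^bold>\<and> B) \<^bold>\<rightarrow> (\<^bold>\<box> B \<^bold>\<rightarrow> \<^bold>\<box> (A \<^bold>\<and> B)) \<in> w"
    by (rule mcs_thm) (simp_all add: assms(1) ILW_star_def IL_plus.L1)
  ultimately show ?thesis using assms by (metis mcs_Imp)
qed

lemma mcs_box_box: "mcs w \<Longrightarrow> \<^bold>\<box> A \<in> w \<Longrightarrow> \<^bold>\<box> \<^bold>\<box> A \<in> w"
  using mcs_thm[of w "\<^bold>\<box> A \<^bold>\<rightarrow> \<^bold>\<box> \<^bold>\<box> A"] by (simp add: ILW_star_def IL_plus.L2)

lemma mcs_Loeb: "mcs w \<Longrightarrow> \<^bold>\<box> (\<^bold>\<box> A \<^bold>\<rightarrow> A) \<in> w \<Longrightarrow> \<^bold>\<box> A \<in> w"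
  using mcs_thm[of w "\<^bold>\<box> (\<^bold>\<box> A \<^bold>\<rightarrow> A) \<^bold>\<rightarrow> \<^bold>\<box> A"] by (simp add: ILW_star_def IL_plus.L3)

lemma mcs_rhd_box: "mcs w \<Longrightarrow> \<^bold>\<box> (A \<^bold>\<rightarrow> B) \<in> w \<Longrightarrow> A \<^bold>\<rhd> B \<in> w"
  using mcs_thm[of w "\<^bold>\<box> (A \<^bold>\<rightarrow> B) \<^bold>\<rightarrow> (A \<^bold>\<rhd> B)"] by (simp add: ILW_star_def IL_plus.J1)

lemma mcs_rhd_imp: "mcs w \<Longrightarrow> (\<And>G. mcs G \<Longrightarrow> A \<in> G \<Longrightarrow> B \<in> G) \<Longrightarrow> A \<^bold>\<rhd> B \<in> w"
  by (intro mcs_rhd_box mcs_box_thm) auto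

lemma mcs_rhd_trans: "mcs w \<Longrightarrow> A \<^bold>\<rhd> B \<in> w \<Longrightarrow> B \<^bold>\<rhd> C \<in> w \<Longrightarrow> A \<^bold>\<rhd> C \<in> w"
  using mcs_thm[of w "((A \<^bold>\<rhd> B) \<^bold>\<and> (B \<^bold>\<rhd> C)) \<^bold>\<rightarrow> (A \<^bold>\<rhd> C)"]
  by (simp add: ILW_star_def IL_plus.J2)

lemma mcs_rhd_or: "mcs w \<Longrightarrow> A \<^bold>\<rhd> C \<in> w \<Longrightarrow> B \<^bold>\<rhd> C \<in> w \<Longrightarrow> (A \<^bold>\<or> B) \<^bold>\<rhd> C \<in> w"
  using mcs_thm[of w "((A \<^bold>\<rhd> C) \<^bold>\<and> (B \<^bold>\<rhd> C)) \<^bold>\<rightarrow> ((A \<^bold>\<or> B) \<^bold>\<rhd> C)"]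
  by (simp add: ILW_star_def IL_plus.J3)

lemma mcs_rhd_dia: "mcs w \<Longrightarrow> \<^bold>\<diamond> A \<^bold>\<rhd> A \<in> w"
  by (rule mcs_thm) (simp_all add: ILW_star_def IL_plus.J5)

lemma mcs_rhd_Bot: 
  assumes "mcs w" "A \<^bold>\<rhd> \<^bold>\<bottom> \<in> w"
  shows "\<^bold>\<box> \<^bold>\<not> A \<in> w"
proof -
  have "(A \<^bold>\<rhd> \<^bold>\<bottom>) \<^bold>\<rightarrow> (\<^bold>\<diamond> A \<^bold>\<rightarrow> \<^bold>\<diamond> \<^bold>\<bottom>) \<in> w"
    by (rule mcs_thm) (simp_all add: assms ILW_star_def IL_plus.J4)
  moreover have "\<^bold>\<box> \<^bold>\<not> \<^bold>\<bottom> \<in> w" by (rule mcs_box_thm) (simp_all add: assms)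
  ultimately show ?thesis using assms by simp
qed

lemma mcs_rhd_dia_box:
  assumes "mcs w" "A \<^bold>\<rhd> B \<in> w" "\<^bold>\<box> \<^bold>\<not> B \<in> w"
  shows "\<^bold>\<box> \<^bold>\<not> A \<in> w"
  using assms mcs_rhd_Bot mcs_rhd_box mcs_rhd_trans by blast

lemma mcs_rhd_Loeb:
  assumes w: "mcs w"
  shows "A \<^bold>\<rhd> (A \<^bold>\<and> \<^bold>\<box> \<^bold>\<not> A) \<in> w"
proof -
  let ?B = "A \<^bold>\<and> \<^bold>\<box> \<^bold>\<not> A"
  have "A \<^bold>\<rhd> (?B \<^bold>\<or> \<^bold>\<diamond> ?B) \<in> w"
  proof (rule mcs_rhd_imp[OF w])
    fix G assume G: "mcs G" "A \<in> G"
    \<comment> \<open>\<open>\<box>\<not>?B\<close> amounts to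
      \<open>\<box>(\<box>\<not>A \<rightarrow> \<not>A)\<close>, so Loeb's axiom applies.\<close>
    have "\<^bold>\<box> \<^bold>\<not> A \<in> G" if "\<^bold>\<box> \<^bold>\<not> ?B \<in> G"
      by (rule mcs_Loeb[OF G(1)], rule mcs_box_mono[OF G(1) that]) auto
    then show "?B \<^bold>\<or> \<^bold>\<diamond> ?B \<in> G" using G by auto
  qed
  moreover have "(?B \<^bold>\<or> \<^bold>\<diamond> ?B) \<^bold>\<rhd> ?B \<in> w"
    using w by (intro mcs_rhd_or mcs_rhd_dia mcs_rhd_imp) auto
  ultimately show ?thesis using mcs_rhd_trans w by blast
qed

section \<open>Principles derived from \<open>W_star\<close>\<close>

lemma mcs_W_star:
  "mcs w \<Longrightarrow> A \<^bold>\<rhd> B \<in> w \<Longrightarrow> (B \<^bold>\<and> \<^bold>\<box> C) \<^bold>\<rhd> (B \<^bold>\<and> \<^bold>\<box> C \<^bold>\<and> \<^bold>\<box> \<^bold>\<not> A) \<in> w"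
  using mcs_thm[of w "(A \<^bold>\<rhd> B) \<^bold>\<rightarrow> ((B \<^bold>\<and> \<^bold>\<box> C) \<^bold>\<rhd> (B \<^bold>\<and> \<^bold>\<box> C \<^bold>\<and> \<^bold>\<box> \<^bold>\<not> A))"]
    mcs_Imp[of w "A \<^bold>\<rhd> B"]
    IL_plus.extra[of _ W_star] unfolding ILW_star_def W_star_def by blast

text \<open>This is the principle W. The trivially true \<open>?T\<close> serves as the box in
  \<open>W_star\<close>; the conjunct \<open>\<box>\<not>A\<close> gained on the right cancels the
  disjunct \<open>\<diamond>A\<close>.\<close>

lemma mcs_W:
  assumes w: "mcs w" and "A \<^bold>\<rhd> (B \<^bold>\<or> \<^bold>\<diamond> A) \<in> w"
  shows "A \<^bold>\<rhd> B \<in> w"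
proof -
  let ?T = "\<^bold>\<box> \<^bold>\<not> \<^bold>\<bottom>" and ?B = "B \<^bold>\<or> \<^bold>\<diamond> A"
  have "?B \<^bold>\<rhd> (?B \<^bold>\<and> ?T) \<in> w"
  proof (rule mcs_rhd_imp[OF w])
    fix G assume "mcs G" "?B \<in> G"
    moreover have "?T \<in> G" by (rule mcs_box_thm) (use \<open>mcs G\<close> in auto)
    ultimately show "?B \<^bold>\<and> ?T \<in> G" by simp
  qed
  moreover have "(?B \<^bold>\<and> ?T) \<^bold>\<rhd> (?B \<^bold>\<and> ?T \<^bold>\<and> \<^bold>\<box> \<^bold>\<not> A) \<in> w"
    using mcs_W_star assms by blast
  moreover have "(?B \<^bold>\<and> ?T \<^bold>\<and> \<^bold>\<box> \<^bold>\<not> A) \<^bold>\<rhd> B \<in> w"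
    by (rule mcs_rhd_imp[OF w]) auto
  ultimately show ?thesis using assms mcs_rhd_trans by blast
qed

text \<open>Apply \<open>W\<^sup>*\<close> to \<open>A \<rhd> B \<or> \<diamond>A\<close>: the disjunct \<open>\<diamond>A\<close> lets the left-hand side start from
  \<open>\<diamond>A \<and> \<box>C\<close>, and \<open>\<box>\<not>A\<close> excludes it on the right.\<close>

lemma mcs_M0:
  assumes w: "mcs w" and "A \<^bold>\<rhd> B \<in> w"
  shows "(\<^bold>\<diamond> A \<^bold>\<and> \<^bold>\<box> C) \<^bold>\<rhd> (B \<^bold>\<and> \<^bold>\<box> C) \<in> w"
proof -
  let ?B = "B \<^bold>\<or> \<^bold>\<diamond> A"
  have "A \<^bold>\<rhd> ?B \<in> w"
    by (rule mcs_rhd_trans[OF w assms(2)], rule mcs_rhd_imp[OF w]) auto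
  then have "(?B \<^bold>\<and> \<^bold>\<box> C) \<^bold>\<rhd> (?B \<^bold>\<and> \<^bold>\<box> C \<^bold>\<and> \<^bold>\<box> \<^bold>\<not> A) \<in> w"
    using mcs_W_star w by blast
  moreover have "(\<^bold>\<diamond> A \<^bold>\<and> \<^bold>\<box> C) \<^bold>\<rhd> (?B \<^bold>\<and> \<^bold>\<box> C) \<in> w"
    by (rule mcs_rhd_imp[OF w]) auto
  moreover have "(?B \<^bold>\<and> \<^bold>\<box> C \<^bold>\<and> \<^bold>\<box> \<^bold>\<not> A) \<^bold>\<rhd> (B \<^bold>\<and> \<^bold>\<box> C) \<in> w"
    by (rule mcs_rhd_imp[OF w]) auto
  ultimately show ?thesis using mcs_rhd_trans w by blast
qed

section \<open>Critical successors\<close>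

primrec dis :: "form \<Rightarrow> form list \<Rightarrow> form" where
  "dis E [] = E"
| "dis E (F # Fs) = \<^bold>\<not> F \<^bold>\<or> dis E Fs"

lemma mcs_dis [simp]: "mcs G \<Longrightarrow> dis E Fs \<in> G \<longleftrightarrow> E \<in> G \<or> (\<exists>F \<in> set Fs. F \<notin> G)"
  by (induction Fs) auto

text \<open>For empty \<open>L\<close> these are the usual \<open>E\<close>-critical successors, in
  general the assuring successors with label \<open>L\<close> and \<open>\<not>E\<close>. The
  customary demand \<open>\<box>\<not>X \<in> z\<close> follows in \<open>crit_box\<close>.\<close>

definition crit :: "form set \<Rightarrow> form \<Rightarrow> form set \<Rightarrow> form set \<Rightarrow> bool" where
  "crit w E L z \<longleftrightarrow> (\<forall>X Fs. set Fs \<subseteq> L \<longrightarrow> X \<^bold>\<rhd> dis E Fs \<in> w \<longrightarrow> X \<notin> z)"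

definition prec :: "form set \<Rightarrow> form set \<Rightarrow> bool" where
  "prec w z \<longleftrightarrow> (\<forall>C. \<^bold>\<box> C \<in> w \<longrightarrow> C \<in> z \<and> \<^bold>\<box> C \<in> z)"

definition boxes :: "form set \<Rightarrow> form set" where
  "boxes w = w \<inter> range Box"

lemma crit_mono: "crit w E L z \<Longrightarrow> L' \<subseteq> L \<Longrightarrow> crit w E L' z"
  unfolding crit_def by blast

lemma crit_not_mem: "mcs w \<Longrightarrow> crit w E L z \<Longrightarrow> E \<notin> z"
  using mcs_rhd_imp[of w E E] unfolding crit_def by (metis dis.simps(1) empty_set empty_subsetI)

text \<open>By \<open>J5\<close>, \<open>\<diamond>X\<close> is excluded along with
  \<open>X\<close>; this is why criticality survives further steps in
  \<open>crit_step\<close>.\<close>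

lemma crit_box:
  assumes "mcs w" "mcs z" "crit w E L z" "set Fs \<subseteq> L" "X \<^bold>\<rhd> dis E Fs \<in> w"
  shows "\<^bold>\<box> \<^bold>\<not> X \<in> z"
proof -
  have "\<^bold>\<diamond> X \<^bold>\<rhd> dis E Fs \<in> w" using assms mcs_rhd_trans mcs_rhd_dia by blast
  then have "\<^bold>\<diamond> X \<notin> z" using assms unfolding crit_def by blast
  then show ?thesis using assms(2) by simp
qed

lemma crit_subset:
  assumes "mcs w" "mcs z" "crit w E L z"
  shows "L \<subseteq> z"
proof
  fix F assume "F \<in> L"
  moreover have "\<^bold>\<not> F \<^bold>\<rhd> dis E [F] \<in> w" by (rule mcs_rhd_imp[OF assms(1)]) auto
  ultimately have "\<^bold>\<not> F \<notin> z"
    using assms(3)[unfolded crit_def, rule_format, of "[F]" "\<^bold>\<not> F"] by simp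
  then show "F \<in> z" using assms(2) by simp
qed

lemma crit_prec:
  assumes "mcs w" "mcs z" "crit w E L z"
  shows "prec w z"
proof -
  have *: "C \<in> z" if "\<^bold>\<box> C \<in> w" for C
  proof -
    have "\<^bold>\<box> (\<^bold>\<not> C \<^bold>\<rightarrow> dis E []) \<in> w" by (rule mcs_box_mono[OF assms(1) that]) auto
    then have "\<^bold>\<not> C \<^bold>\<rhd> dis E [] \<in> w" using mcs_rhd_box assms(1) by blast
    then have "\<^bold>\<not> C \<notin> z"
      using assms(3)[unfolded crit_def, rule_format, of "[]" "\<^bold>\<not> C"] by simp
    then show ?thesis using assms(2) by simp
  qed
  then show ?thesis using mcs_box_box assms(1) unfolding prec_def by blast
qed

lemma crit_step:
  assumes "mcs w" "mcs z" "mcs u" "crit w E L z" "prec z u"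
  shows "crit w E L u"
  unfolding crit_def
proof (intro allI impI)
  fix X Fs assume "set Fs \<subseteq> L" "X \<^bold>\<rhd> dis E Fs \<in> w"
  then have "\<^bold>\<not> X \<in> u" using crit_box[OF assms(1,2,4)] assms(5) unfolding prec_def by blast
  then show "X \<notin> u" using assms(3) by auto
qed

lemma crit_Bot:
  assumes "mcs w" "mcs z" "prec w z"
  shows "crit w \<^bold>\<bottom> {} z"
  unfolding crit_def
proof (intro allI impI)
  fix X Fs assume "set Fs \<subseteq> ({} :: form set)" "X \<^bold>\<rhd> dis \<^bold>\<bottom> Fs \<in> w"
  then have "\<^bold>\<not> X \<in> z" using mcs_rhd_Bot assms unfolding prec_def by auto
  then show "X \<notin> z" using assms(2) by auto
qed

text \<open>The formulas \<open>X\<close> with \<open>X \<rhd> dis E Fs \<in> w\<close> for some \<open>Fs\<close> from \<open>L\<close> form an ideal, so the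
  negations of its members are refuted together only if a single one is.\<close>

lemma crit_exists:
  assumes w: "mcs w" and Q: "\<And>Fs. set Fs \<subseteq> L \<Longrightarrow> Q \<^bold>\<rhd> dis E Fs \<notin> w"
  obtains z where "mcs z" "Q \<in> z" "\<^bold>\<box> \<^bold>\<not> Q \<in> z" "crit w E L z"
proof -
  define Q' where "Q' = Q \<^bold>\<and> \<^bold>\<box> \<^bold>\<not> Q"
  define I where "I = {X. \<exists>Fs. set Fs \<subseteq> L \<and> X \<^bold>\<rhd> dis E Fs \<in> w}"
  have Bot: "\<^bold>\<bottom> \<in> I"
    unfolding I_def using w by (auto intro!: exI[of _ "[]"] mcs_rhd_imp)
  have or: "X \<^bold>\<or> Y \<in> I" if XY: "X \<in> I" "Y \<in> I" for X Y
  proof -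
    obtain Fs Gs where *: "set Fs \<subseteq> L" "X \<^bold>\<rhd> dis E Fs \<in> w" "set Gs \<subseteq> L" "Y \<^bold>\<rhd> dis E Gs \<in> w"
      using XY unfolding I_def by blast
    have "dis E Fs \<^bold>\<rhd> dis E (Fs @ Gs) \<in> w" "dis E Gs \<^bold>\<rhd> dis E (Fs @ Gs) \<in> w"
      by (rule mcs_rhd_imp[OF w]; auto)+
    then have "(X \<^bold>\<or> Y) \<^bold>\<rhd> dis E (Fs @ Gs) \<in> w"
      using mcs_rhd_or[OF w] mcs_rhd_trans[OF w *(2)] mcs_rhd_trans[OF w *(4)] by simp
    then show ?thesis using * unfolding I_def by (auto intro!: exI[of _ "Fs @ Gs"])
  qed
  have ded: "\<exists>X\<in>I. \<forall>G. mcs G \<longrightarrow> Q' \<in> G \<longrightarrow> X \<in> G \<or> A \<in> G"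
    if "A \<in> ded (insert Q' (Neg ` I))" for A
    using that
  proof (induction rule: ded.induct)
    case (hyp A)
    then show ?case using Bot by auto
  next
    case (ax A)
    then show ?case using Bot mcs_thm by blast
  next
    case (mp A B)
    then obtain X Y where "X \<in> I" "\<forall>G. mcs G \<longrightarrow> Q' \<in> G \<longrightarrow> X \<in> G \<or> A \<^bold>\<rightarrow> B \<in> G"
      "Y \<in> I" "\<forall>G. mcs G \<longrightarrow> Q' \<in> G \<longrightarrow> Y \<in> G \<or> A \<in> G" by auto
    then show ?case using or by (intro bexI[of _ "X \<^bold>\<or> Y"]) auto
  qed
  have "\<^bold>\<bottom> \<notin> ded (insert Q' (Neg ` I))"
  proof
    assume "\<^bold>\<bottom> \<in> ded (insert Q' (Neg ` I))"
    then obtain X where X: "X \<in> I" "\<And>G. mcs G \<Longrightarrow> Q' \<in> G \<Longrightarrow> X \<in> G" using ded by fastforce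
    then obtain Fs where Fs: "set Fs \<subseteq> L" "X \<^bold>\<rhd> dis E Fs \<in> w" unfolding I_def by auto
    have "Q' \<^bold>\<rhd> X \<in> w" using X(2) mcs_rhd_imp w by blast
    moreover have "Q \<^bold>\<rhd> Q' \<in> w" unfolding Q'_def using mcs_rhd_Loeb w by blast
    ultimately show False using Q Fs w mcs_rhd_trans by blast
  qed
  then obtain z where z: "mcs z" "insert Q' (Neg ` I) \<subseteq> z" using Lindenbaum by blast
  have "X \<notin> z" if "X \<in> I" for X
    using z that by (metis imageI insert_subset mcs_Bot mcs_Imp subsetD)
  then have "crit w E L z" unfolding crit_def I_def by blast
  then show ?thesis using that z unfolding Q'_def by auto
qed

text \<open>A member \<open>\<box>\<not>A\<close> of \<open>Fs\<close> contributes the disjunct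
  \<open>\<diamond>A\<close>, which principle W deletes.\<close>

lemma rhd_remove_dia:
  assumes w: "mcs w" and AB: "A \<^bold>\<rhd> B \<in> w" and "B \<^bold>\<rhd> dis E Fs \<in> w"
    and "set Fs \<subseteq> insert (\<^bold>\<box> \<^bold>\<not> A) L"
  obtains Gs where "set Gs \<subseteq> L" "A \<^bold>\<rhd> dis E Gs \<in> w"
proof -
  let ?Gs = "filter (\<lambda>F. F \<in> L) Fs"
  have "dis E Fs \<^bold>\<rhd> (dis E ?Gs \<^bold>\<or> \<^bold>\<diamond> A) \<in> w"
  proof (rule mcs_rhd_imp[OF w])
    fix G assume "mcs G" "dis E Fs \<in> G"
    then show "dis E ?Gs \<^bold>\<or> \<^bold>\<diamond> A \<in> G" using assms(4) by auto
  qed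
  then have "A \<^bold>\<rhd> (dis E ?Gs \<^bold>\<or> \<^bold>\<diamond> A) \<in> w" using assms mcs_rhd_trans by blast
  then have "A \<^bold>\<rhd> dis E ?Gs \<in> w" by (rule mcs_W[OF w])
  then show ?thesis using that[of ?Gs] by auto
qed

lemma crit_exists_W:
  assumes w: "mcs w" and y: "crit w E L y" "A \<in> y" and AB: "A \<^bold>\<rhd> B \<in> w"
  obtains z where "mcs z" "B \<in> z" "\<^bold>\<box> \<^bold>\<not> B \<in> z" "crit w E (insert (\<^bold>\<box> \<^bold>\<not> A) L) z"
proof (rule crit_exists[OF w])
  fix Fs assume Fs: "set Fs \<subseteq> insert (\<^bold>\<box> \<^bold>\<not> A) L"
  show "B \<^bold>\<rhd> dis E Fs \<notin> w"
  proof
    assume "B \<^bold>\<rhd> dis E Fs \<in> w"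
    then obtain Gs where "set Gs \<subseteq> L" "A \<^bold>\<rhd> dis E Gs \<in> w"
      using rhd_remove_dia[OF w AB _ Fs] by blast
    then show False using y unfolding crit_def by blast
  qed
qed (use that in blast)

text \<open>\<open>mcs_M0\<close> carries one boxed formula, so finitely many are packed into
  one.\<close>

lemma boxes_single:
  assumes x: "mcs x" and "set Fs \<subseteq> boxes x"
  obtains C where "\<^bold>\<box> C \<in> x" "\<And>G. mcs G \<Longrightarrow> \<^bold>\<box> C \<in> G \<Longrightarrow> set Fs \<subseteq> G"
  using assms(2)
proof (induction Fs arbitrary: thesis)
  case Nil
  have "\<^bold>\<box> \<^bold>\<not> \<^bold>\<bottom> \<in> x" by (rule mcs_box_thm[OF x]) simp
  then show ?case using Nil by auto
next
  case (Cons F Fs)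
  obtain C where C: "\<^bold>\<box> C \<in> x" "\<And>G. mcs G \<Longrightarrow> \<^bold>\<box> C \<in> G \<Longrightarrow> set Fs \<subseteq> G"
    using Cons by auto
  obtain D where D: "F = \<^bold>\<box> D" "\<^bold>\<box> D \<in> x" using Cons by (auto simp: boxes_def)
  show ?case
  proof (rule Cons.prems(1))
    show "\<^bold>\<box> (D \<^bold>\<and> C) \<in> x" using C D mcs_box_conj x by blast
    fix G assume G: "mcs G" "\<^bold>\<box> (D \<^bold>\<and> C) \<in> G"
    have "\<^bold>\<box> D \<in> G" by (rule mcs_box_mono[OF G]) auto
    moreover have "\<^bold>\<box> C \<in> G" by (rule mcs_box_mono[OF G]) auto
    ultimately show "set (F # Fs) \<subseteq> G" using C G D by auto
  qed
qed

text \<open>Here \<open>A\<close> is only known to be possible at \<open>x\<close>. By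
  \<open>mcs_M0\<close> a box \<open>\<box>C\<close> from \<open>x\<close> is carried over; on the
  right it refutes the disjuncts from \<open>Gs\<close> and leaves \<open>E\<close>.\<close>

lemma crit_exists_M0:
  assumes w: "mcs w" and x: "mcs x" "crit w E {} x" "\<^bold>\<box> \<^bold>\<not> A \<notin> x" and AB: "A \<^bold>\<rhd> B \<in> w"
  obtains z where "mcs z" "B \<in> z" "\<^bold>\<box> \<^bold>\<not> B \<in> z" "crit w E (insert (\<^bold>\<box> \<^bold>\<not> A) (boxes x)) z"
proof (rule crit_exists[OF w])
  fix Fs assume Fs: "set Fs \<subseteq> insert (\<^bold>\<box> \<^bold>\<not> A) (boxes x)"
  show "B \<^bold>\<rhd> dis E Fs \<notin> w"
  proof
    assume "B \<^bold>\<rhd> dis E Fs \<in> w"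
    then obtain Gs where Gs: "set Gs \<subseteq> boxes x" "A \<^bold>\<rhd> dis E Gs \<in> w"
      using rhd_remove_dia[OF w AB _ Fs] by blast
    obtain C where C: "\<^bold>\<box> C \<in> x" "\<And>G. mcs G \<Longrightarrow> \<^bold>\<box> C \<in> G \<Longrightarrow> set Gs \<subseteq> G"
      using boxes_single[OF x(1) Gs(1)] by blast
    have "(dis E Gs \<^bold>\<and> \<^bold>\<box> C) \<^bold>\<rhd> dis E [] \<in> w"
      by (rule mcs_rhd_imp[OF w]) (use C(2) in auto)
    then have "(\<^bold>\<diamond> A \<^bold>\<and> \<^bold>\<box> C) \<^bold>\<rhd> dis E [] \<in> w" using mcs_M0[OF w Gs(2)] mcs_rhd_trans w by blast
    then have "\<^bold>\<diamond> A \<^bold>\<and> \<^bold>\<box> C \<notin> x"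
      using x(2)[unfolded crit_def, rule_format, of "[]"] by simp
    then show False using x C by simp
  qed
qed (use that in blast)

section \<open>The canonical tree\<close>

text \<open>A node other than the root hangs below its tree parent \<open>par\<close> and is an immediate
  successor of \<open>pp\<close>, an ancestor of \<open>par\<close> or \<open>par\<close> itself. The box formulas of \<open>par\<close> are kept,
  and the node is \<open>crt\<close>-critical over \<open>pp\<close> relative to the set \<open>lab\<close> of box formulas.\<close>

datatype node =
  Root (mu: "form set")
| Node (par: node) (pp: node) (mu: "form set") (crt: form) (lab: "form set")

primrec le :: "node \<Rightarrow> node \<Rightarrow> bool"  (infix "\<preceq>" 50) where
  "x \<preceq> Root G \<longleftrightarrow> x = Root G"
| "x \<preceq> Node t p G E L \<longleftrightarrow> x = Node t p G E L \<or> x \<preceq> t"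

lemma le_refl [simp]: "x \<preceq> x"
  by (cases x) auto

lemma le_trans: "x \<preceq> y \<Longrightarrow> y \<preceq> z \<Longrightarrow> x \<preceq> z"
  by (induction z) auto

lemma le_linear: "x \<preceq> z \<Longrightarrow> y \<preceq> z \<Longrightarrow> x \<preceq> y \<or> y \<preceq> x"
  by (induction z) auto

lemma le_size: "x \<preceq> z \<Longrightarrow> x = z \<or> size x < size z"
  by (induction z) auto

lemma le_antisym: "x \<preceq> y \<Longrightarrow> y \<preceq> x \<Longrightarrow> x = y"
  using le_size[of x y] le_size[of y x] by auto

lemma le_max:
  assumes "x \<preceq> z" "P x"
  obtains m where "m \<preceq> z" "P m" "\<And>x. x \<preceq> z \<Longrightarrow> P x \<Longrightarrow> x \<preceq> m"
  using assms
proof (induction z arbitrary: thesis)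
  case (Root G)
  then show ?case by auto
next
  case (Node t p G E L)
  show ?case
  proof (cases "P (Node t p G E L)")
    case True
    then show ?thesis using Node.prems(1)[of "Node t p G E L"] by auto
  next
    case False
    then have "x \<preceq> t" using Node.prems by auto
    then obtain m where "m \<preceq> t" "P m" "\<And>x. x \<preceq> t \<Longrightarrow> P x \<Longrightarrow> x \<preceq> m"
      using Node.IH(1) Node.prems(3) by blast
    then show ?thesis using Node.prems(1)[of m] False by auto
  qed
qed

definition base :: "node \<Rightarrow> node \<Rightarrow> bool" where
  "base w b \<longleftrightarrow> (\<exists>t G E L. b = Node t w G E L)"

definition acc :: "node \<Rightarrow> node \<Rightarrow> bool" where
  "acc x z \<longleftrightarrow> (\<exists>p. base p z \<and> x \<preceq> p)"

lemma base_acc: "base p z \<Longrightarrow> acc x z \<longleftrightarrow> x \<preceq> p"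
  by (auto simp: acc_def base_def)

lemma acc_base: "acc x z \<Longrightarrow> base (pp z) z"
  by (auto simp: acc_def base_def)

lemma base_par: "base p z \<Longrightarrow> x \<preceq> z \<longleftrightarrow> x = z \<or> x \<preceq> par z"
  by (auto simp: base_def)

lemma base_size: "base p z \<Longrightarrow> size (par z) < size z \<and> size p < size z"
  by (auto simp: base_def)

lemma le_acc: "x \<preceq> y \<Longrightarrow> acc y z \<Longrightarrow> acc x z"
  using le_trans unfolding acc_def by blast

lemma acc_not_le: "acc x z \<Longrightarrow> \<not> z \<preceq> x"
  using le_size[of z x] le_size[of x "pp z"] base_size[of "pp z" z] base_acc[of "pp z" z x]
    acc_base[of x z]
  by auto

text \<open>\<open>anchors w y\<close> contains the \<open>x\<close> that the \<open>srel w\<close>-successors of \<open>y\<close> must have as ancestors,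
  \<open>avoids w y\<close> the formulas that they must avoid. A deficiency is resolved below the greatest
  element of \<open>anchors w y\<close>, or below \<open>w\<close> if there is none.\<close>

definition anchors :: "node \<Rightarrow> node \<Rightarrow> node set" where
  "anchors w y = {x. acc w x \<and> x \<preceq> (if base w y then par y else pp y)}"

definition avoids :: "node \<Rightarrow> node \<Rightarrow> form set" where
  "avoids w y = {crt b |b. base w b \<and> (b = y \<or> b \<in> anchors w y)}"

text \<open>Growth is demanded only at points with a predecessor; the start of a chain may be
  exceptional, as a base over \<open>w\<close> is for \<open>kept w\<close>.\<close>

lemma conv_wf_on_measure:
  fixes f :: "'a \<Rightarrow> nat"
  assumes bound: "\<And>x. f x \<le> n"
    and incr: "\<And>a b c. (a, b) \<in> r \<Longrightarrow> (b, c) \<in> r \<Longrightarrow> f b < f c"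
  shows "conv_wf_on W r"
  unfolding conv_wf_on_def
proof (intro allI impI)
  fix X :: "'a set" assume X: "X \<noteq> {}"
  show "\<exists>m\<in>X. \<forall>y\<in>X. (m, y) \<notin> r"
  proof (rule ccontr)
    assume "\<not> ?thesis"
    then have succ: "\<And>m. m \<in> X \<Longrightarrow> \<exists>y\<in>X. (m, y) \<in> r" by blast
    have "\<exists>b\<in>X. (\<exists>a. (a, b) \<in> r) \<and> k \<le> f b" for k
    proof (induction k)
      case 0
      then show ?case using succ X by blast
    next
      case (Suc k)
      then obtain a b where b: "b \<in> X" "(a, b) \<in> r" "k \<le> f b" by blast
      then obtain c where "c \<in> X" "(b, c) \<in> r" using succ by blast
      then show ?case using incr[OF b(2)] b(3) by force
    qed
    from this[of "Suc n"] obtain b where "Suc n \<le> f b" by blast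
    then show False using bound[of b] by simp
  qed
qed

section \<open>Valid nodes and criticality along branches\<close>

locale canonical =
  fixes D :: "form set"
  assumes finite_D: "finite D"
begin

text \<open>The finite supply of boxes by which progress is counted: a valid node has one that its
  \<open>pp\<close> lacks.\<close>

definition N :: "form set" where
  "N = (\<lambda>A. \<^bold>\<box> \<^bold>\<not> A) ` D"

text \<open>For \<open>t \<noteq> p\<close> the boxes of \<open>t\<close> go into \<open>L\<close>,
  so that a sibling critical relative to \<open>L\<close> keeps them too. A new \<open>E\<close>
  other than bottom can enter only directly below \<open>p\<close>, and bases over \<open>p\<close>
  on one branch share their formula.\<close>

primrec valid :: "node \<Rightarrow> bool" where
  "valid (Root G) \<longleftrightarrow> mcs G"
| "valid (Node t p G E L) \<longleftrightarrow> valid t \<and> p \<preceq> t \<and> mcs G \<and> crit (mu p) E L G \<and>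
    boxes (mu t) \<subseteq> G \<and> L \<subseteq> range Box \<and> (\<exists>A \<in> D. \<^bold>\<box> \<^bold>\<not> A \<in> G \<and> \<^bold>\<box> \<^bold>\<not> A \<notin> mu p) \<and>
    (t \<noteq> p \<longrightarrow> acc p t \<and> boxes (mu t) \<subseteq> L \<and>
      (E = \<^bold>\<bottom> \<or> (\<exists>b. b \<preceq> t \<and> base p b \<and> crt b = E))) \<and>
    (\<forall>b. b \<preceq> t \<longrightarrow> base p b \<longrightarrow> crt b = E)"

lemma valid_le: "valid z \<Longrightarrow> x \<preceq> z \<Longrightarrow> valid x"
proof (induction z)
  case (Node t p G E L)
  then show ?case by (cases "x \<preceq> t") auto
qed simp

lemma valid_mcs: "valid z \<Longrightarrow> mcs (mu z)"
  by (cases z) auto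

lemma valid_base:
  assumes "valid z" "base p z"
  shows "p \<preceq> par z" "crit (mu p) (crt z) (lab z) (mu z)" "lab z \<subseteq> range Box"
    "\<exists>A \<in> D. \<^bold>\<box> \<^bold>\<not> A \<in> mu z \<and> \<^bold>\<box> \<^bold>\<not> A \<notin> mu p"
    "\<And>b. b \<preceq> par z \<Longrightarrow> base p b \<Longrightarrow> crt b = crt z" "p \<preceq> z" "valid p" "valid (par z)"
proof -
  obtain t G E L where z: "z = Node t p G E L" using assms(2) unfolding base_def by blast
  show "p \<preceq> par z" "crit (mu p) (crt z) (lab z) (mu z)" "lab z \<subseteq> range Box"
    "\<exists>A \<in> D. \<^bold>\<box> \<^bold>\<not> A \<in> mu z \<and> \<^bold>\<box> \<^bold>\<not> A \<notin> mu p"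
    "\<And>b. b \<preceq> par z \<Longrightarrow> base p b \<Longrightarrow> crt b = crt z" "p \<preceq> z" "valid p" "valid (par z)"
    using assms(1) valid_le unfolding z by auto
qed

lemma valid_base_par:
  assumes "valid z" "base p z" "par z \<noteq> p"
  shows "acc p (par z)" "boxes (mu (par z)) \<subseteq> lab z"
    "crt z = \<^bold>\<bottom> \<or> (\<exists>b. b \<preceq> par z \<and> base p b \<and> crt b = crt z)"
proof -
  obtain t G E L where z: "z = Node t p G E L" using assms(2) unfolding base_def by blast
  show "acc p (par z)" "boxes (mu (par z)) \<subseteq> lab z"
    "crt z = \<^bold>\<bottom> \<or> (\<exists>b. b \<preceq> par z \<and> base p b \<and> crt b = crt z)"
    using assms(1,3) unfolding z by auto
qed

lemma le_boxes: "valid z \<Longrightarrow> x \<preceq> z \<Longrightarrow> boxes (mu x) \<subseteq> mu z"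
proof (induction z)
  case (Root G)
  then show ?case by (auto simp: boxes_def)
next
  case (Node t p G E L)
  show ?case
  proof (cases "x \<preceq> t")
    case True
    then have "boxes (mu x) \<subseteq> mu t" using Node by simp
    then show ?thesis using Node.prems by (auto simp: boxes_def)
  next
    case False
    then show ?thesis using Node.prems by (auto simp: boxes_def)
  qed
qed

lemma N_boxes: "A \<in> N \<Longrightarrow> A \<in> w \<Longrightarrow> A \<in> boxes w"
  by (auto simp: N_def boxes_def)

lemma le_N: "valid z \<Longrightarrow> x \<preceq> z \<Longrightarrow> N \<inter> mu x \<subseteq> N \<inter> mu z"
  using le_boxes N_boxes by blast

text \<open>Up to \<open>p\<close> only the boxed formulas are kept; the critical step from
  \<open>p\<close> to \<open>z\<close> releases their bodies.\<close>

lemma acc_prec: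
  assumes "valid z" "acc x z"
  shows "prec (mu x) (mu z)"
proof -
  obtain p where p: "base p z" "x \<preceq> p" using assms(2) unfolding acc_def by blast
  note v = valid_base[OF assms(1) p(1)]
  have "prec (mu p) (mu z)" using crit_prec v valid_mcs assms(1) by blast
  moreover have "boxes (mu x) \<subseteq> mu p" using le_boxes v(7) p(2) by blast
  ultimately show ?thesis unfolding prec_def boxes_def by blast
qed

lemma acc_le:
  assumes "valid z" "acc x z"
  shows "x \<preceq> par z" "x \<preceq> z" "valid x"
proof -
  obtain p where p: "base p z" "x \<preceq> p" using assms(2) unfolding acc_def by blast
  note v = valid_base[OF assms(1) p(1)]
  show "x \<preceq> par z" "x \<preceq> z" "valid x" using v p le_trans valid_le by blast+
qed

lemma acc_N:
  assumes "valid z" "acc x z"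
  shows "N \<inter> mu x \<subset> N \<inter> mu z"
proof -
  obtain p where p: "base p z" "x \<preceq> p" using assms(2) unfolding acc_def by blast
  note v = valid_base[OF assms(1) p(1)]
  have "N \<inter> mu x \<subseteq> N \<inter> mu p" using le_N v(7) p(2) by blast
  also have "\<dots> \<subset> N \<inter> mu z" using v(4) le_N[OF assms(1) v(6)] by (auto simp: N_def)
  finally show ?thesis .
qed

lemma acc_trans:
  assumes "valid z" "acc x y" "acc y z"
  shows "acc x z"
  using assms acc_le le_acc by blast

lemma acc_not_base:
  assumes "acc w x" "acc x y"
  shows "\<not> base w y"
  using assms base_acc acc_not_le by blast

lemma anchors_not_base:
  assumes "acc w y" "\<not> base w y"
  shows "x \<in> anchors w y \<longleftrightarrow> acc w x \<and> acc x y"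
  using assms(2) base_acc[OF acc_base[OF assms(1)]] by (simp add: anchors_def)

lemma anchors_lt:
  assumes "valid y" "acc w y" "x \<in> anchors w y"
  shows "acc w x" "x \<preceq> par y"
proof -
  show "acc w x" using assms(3) by (simp add: anchors_def)
  show "x \<preceq> par y"
  proof (cases "base w y")
    case True
    then show ?thesis using assms(3) by (simp add: anchors_def)
  next
    case False
    then show ?thesis using assms anchors_not_base acc_le by blast
  qed
qed

lemma anchors_le: "valid y \<Longrightarrow> acc w y \<Longrightarrow> x \<in> anchors w y \<Longrightarrow> x \<preceq> y"
  using anchors_lt(2) base_par acc_base by blast

lemma base_crt_unique:
  assumes "valid x" "b \<preceq> x" "base w b" "b' \<preceq> x" "base w b'"
  shows "crt b = crt b'"
proof -
  have *: "crt b = crt b'" if "valid b'" "b \<preceq> b'" "base w b" "base w b'" for b b'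
    using that valid_base(5) base_par by metis
  show ?thesis using le_linear[OF assms(2,4)] * assms valid_le by metis
qed

text \<open>Criticality is inherited along the tree order and not only along \<open>acc\<close>: if \<open>b \<preceq> x\<close> is not
  an \<open>acc\<close>-predecessor of \<open>x\<close>, its formula comes from a smaller base.\<close>

lemma base_crit:
  assumes x: "valid x" "acc w x"
  shows "b \<preceq> x \<Longrightarrow> base w b \<Longrightarrow> crit (mu w) (crt b) {} (mu x)"
proof (induction b rule: measure_induct_rule[of size])
  case (less b)
  have mx: "mcs (mu x)" "mcs (mu w)" using x acc_le valid_mcs by blast+
  have b: "valid b" using less.prems x valid_le by blast
  note vb = valid_base[OF b less.prems(2)]
  show ?case
  proof (cases "base w x")
    case True
    then show ?thesis
      using base_crt_unique[OF x(1) less.prems le_refl True] valid_base(2)[OF x(1) True]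
      by (auto intro: crit_mono)
  next
    case False
    define v where "v = pp x"
    have v: "base v x" "w \<preceq> v" using acc_base[OF x(2)] x(2) base_acc v_def by auto
    have wv: "w \<noteq> v" using False v(1) by auto
    note vx = valid_base[OF x(1) v(1)]
    show ?thesis
    proof (cases "b \<preceq> v")
      case True
      then have "acc b x" using base_acc v(1) by blast
      then have "prec (mu b) (mu x)" using acc_prec x by blast
      then show ?thesis
        using crit_step[OF mx(2) valid_mcs[OF b] mx(1) vb(2)] crit_mono by blast
    next
      case False
      then have "v \<preceq> b" using vx(6) less.prems(1) le_linear by blast
      then have vb': "v \<preceq> par b" using base_par[OF less.prems(2), of v] False by auto
      \<comment> \<open>As \<open>b\<close> does not hang directly below \<open>w\<close>, validity
        leaves only bottom or a formula inherited from an earlier base.\<close>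
      have "par b \<noteq> w" using vb' v(2) wv le_antisym by blast
      then consider "crt b = \<^bold>\<bottom>" | b1 where "b1 \<preceq> par b" "base w b1" "crt b1 = crt b"
        using valid_base_par[OF b less.prems(2)] by blast
      then show ?thesis
      proof cases
        case 1
        then show ?thesis using crit_Bot mx acc_prec x by metis
      next
        case (2 b1)
        have "size b1 < size b" using 2(1) le_size base_size less.prems(2) by fastforce
        moreover have "b1 \<preceq> x"
          using 2(1) less.prems base_par[OF less.prems(2)] le_trans by blast
        ultimately show ?thesis using less.IH[of b1] 2 by simp
      qed
    qed
  qed
qed

section \<open>The relations \<open>srel w\<close>\<close>

text \<open>\<open>kept w y\<close> collects box formulas of \<open>N\<close> that survive along \<open>srel w\<close>. It grows strictly along
  \<open>srel w\<close> from \<open>y\<close> when \<open>y\<close> is not an immediate successor of \<open>w\<close>, which makes \<open>srel w O acc\<close>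
  conversely well-founded.\<close>

definition kept :: "node \<Rightarrow> node \<Rightarrow> form set" where
  "kept w y = N \<inter> (if base w y then lab y else \<Union> (mu ` anchors w y))"

text \<open>The inclusions serve, in turn, the second frame condition, converse well-foundedness and
  the refutation of \<open>\<rhd>\<close>. Growth is waived at bases, where the label may already
  contain the box to be added; only the start of an \<open>srel w O acc\<close> chain can be a base
  over \<open>w\<close>.\<close>

definition srel :: "node \<Rightarrow> node \<Rightarrow> node \<Rightarrow> bool" where
  "srel w y z \<longleftrightarrow> acc w y \<and> acc w z \<and> (y = z \<or>
    anchors w y \<subseteq> anchors w z \<and> kept w y \<subseteq> kept w z \<and> avoids w y \<subseteq> avoids w z \<and>
    (base w y \<or> kept w y \<noteq> kept w z))"

lemma kept_mu:
  assumes "valid y" "acc w y"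
  shows "kept w y \<subseteq> N \<inter> mu y"
proof (cases "base w y")
  case True
  then have "lab y \<subseteq> mu y"
    using crit_subset valid_mcs assms(1) valid_base(2,7) by blast
  then show ?thesis using True by (auto simp: kept_def)
next
  case False
  have "N \<inter> mu x \<subseteq> mu y" if "x \<in> anchors w y" for x
    using that le_N anchors_le assms by blast
  then show ?thesis using False by (auto simp: kept_def)
qed

text \<open>All anchors are \<open>\<preceq> pp y\<close>, and \<open>y\<close> has a member of
  \<open>N\<close> that \<open>pp y\<close> lacks.\<close>

lemma kept_not_base:
  assumes "valid y" "acc w y" "\<not> base w y"
  shows "kept w y \<subset> N \<inter> mu y"
proof -
  have b: "base (pp y) y" using acc_base assms(2) by blast
  have "valid (pp y)" using valid_base(7) b assms(1) by blast
  then have "N \<inter> mu x \<subseteq> N \<inter> mu (pp y)" if "x \<in> anchors w y" for x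
    using that assms(3) le_N[of "pp y" x] by (simp add: anchors_def)
  then have "kept w y \<subseteq> N \<inter> mu (pp y)" using assms(3) by (auto simp: kept_def)
  also have "\<dots> \<subset> N \<inter> mu y" using acc_N[OF assms(1)] b base_acc by simp
  finally show ?thesis .
qed

lemma mu_kept:
  assumes "acc w x" "acc x y" "valid y"
  shows "N \<inter> mu x \<subseteq> kept w y"
proof -
  have "\<not> base w y" "x \<in> anchors w y" "acc w y"
    using assms acc_not_base anchors_not_base acc_trans by blast+
  then show ?thesis by (auto simp: kept_def)
qed

lemma acc_imp_srel:
  assumes wx: "acc w x" and xy: "acc x y" and y: "valid y"
  shows "srel w x y"
proof -
  have x: "valid x" using acc_le y xy by blast
  have wy: "acc w y" using assms acc_trans by blast
  have nb: "\<not> base w y" using acc_not_base assms by blast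
  have anchors: "u \<in> anchors w y" if "acc w u" "u \<preceq> x" for u
    using that anchors_not_base[OF wy nb] le_acc xy by blast
  have "anchors w x \<subseteq> anchors w y" using anchors anchors_le anchors_lt(1) x wx by blast
  \<comment> \<open>If \<open>x\<close> is a base over \<open>w\<close>, its formula stays avoided
    because \<open>x\<close> itself is an anchor of \<open>y\<close>.\<close>
  moreover have "avoids w x \<subseteq> avoids w y"
    using \<open>anchors w x \<subseteq> anchors w y\<close> anchors[OF wx le_refl] by (auto simp: avoids_def)
  moreover have "kept w x \<subseteq> kept w y" using kept_mu[OF x wx] mu_kept[OF wx xy y] by blast
  moreover have "base w x \<or> kept w x \<noteq> kept w y"
    using kept_not_base[OF x wx] mu_kept[OF wx xy y] by blast
  ultimately show ?thesis using wx wy unfolding srel_def by blast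
qed

lemma srel_trans: "srel w x y \<Longrightarrow> srel w y z \<Longrightarrow> srel w x z"
  unfolding srel_def by blast

lemma srel_acc_M0:
  assumes "valid z" "acc w x" "acc x y" "srel w y y'" "acc y' z"
  shows "acc x z"
proof -
  have y': "valid y'" "acc w y'" using assms acc_le unfolding srel_def by blast+
  have "x \<preceq> y'"
  proof (cases "y = y'")
    case True
    then show ?thesis using assms y' acc_le by blast
  next
    case False
    have "x \<in> anchors w y"
      using anchors_not_base[of w y x] acc_not_base[OF assms(2,3)] assms(2,3,4)
      unfolding srel_def by blast
    then have "x \<in> anchors w y'" using False assms(4) unfolding srel_def by blast
    then show ?thesis using anchors_le y' by blast
  qed
  then show ?thesis using le_acc assms by blast
qed

text \<open>Growth comes from \<open>srel\<close> if \<open>y \<noteq> z\<close>, and from the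
  \<open>acc\<close>-step if \<open>y = z\<close>.\<close>

lemma srel_acc_kept:
  assumes "valid y" "valid c" "\<not> base w y" "srel w y z" "acc z c"
  shows "kept w y \<subset> kept w c"
proof -
  have y: "acc w y" "acc w z" "valid z" using assms acc_le unfolding srel_def by blast+
  have zc: "N \<inter> mu z \<subseteq> kept w c" using mu_kept y assms by blast
  show ?thesis
  proof (cases "y = z")
    case True
    then show ?thesis using zc kept_not_base[OF assms(1) y(1) assms(3)] by blast
  next
    case False
    then have "kept w y \<subset> kept w z" using assms(3,4) unfolding srel_def by blast
    then show ?thesis using zc kept_mu[OF y(3,2)] by blast
  qed
qed

section \<open>Witnesses for failing and holding \<open>\<rhd>\<close>-formulas\<close>

lemma problem:
  assumes w: "valid w" and AB: "A \<^bold>\<rhd> B \<notin> mu w" and A: "A \<in> D"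
  obtains z where "valid z" "acc w z" "A \<in> mu z"
    "\<And>v. valid v \<Longrightarrow> srel w z v \<Longrightarrow> B \<notin> mu v"
proof -
  have mw: "mcs (mu w)" using w valid_mcs by blast
  obtain G where G: "mcs G" "A \<in> G" "\<^bold>\<box> \<^bold>\<not> A \<in> G" "crit (mu w) B {} G"
    by (rule crit_exists[OF mw, of "{}" A B]) (use AB in auto)
  \<comment> \<open>As a base over \<open>w\<close> with formula \<open>B\<close>, this node puts
    \<open>B\<close> into \<open>avoids w z\<close>, which every \<open>srel w\<close>-successor
    inherits.\<close>
  define z where "z = Node w w G B {}"
  have nA: "\<^bold>\<box> \<^bold>\<not> A \<notin> mu w"
  proof
    assume *: "\<^bold>\<box> \<^bold>\<not> A \<in> mu w"
    have "\<^bold>\<box> (A \<^bold>\<rightarrow> B) \<in> mu w" by (rule mcs_box_mono[OF mw *]) auto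
    then show False using mcs_rhd_box mw AB by blast
  qed
  have bx: "boxes (mu w) \<subseteq> G"
    using crit_prec[OF mw G(1,4)] by (auto simp: boxes_def prec_def)
  have z: "valid z"
    unfolding z_def using w G nA A bx base_acc acc_not_le by auto
  have bz: "base w z" by (auto simp: z_def base_def)
  then have wz: "acc w z" using base_acc by simp
  have "B \<notin> mu v" if v: "valid v" "srel w z v" for v
  proof -
    have wv: "acc w v" using v unfolding srel_def by blast
    have "B \<in> avoids w z" using bz by (auto simp: avoids_def z_def intro!: exI[of _ z])
    then have "B \<in> avoids w v" using v(2) unfolding srel_def by blast
    then obtain b where "crt b = B" "base w b" "b = v \<or> b \<in> anchors w v" by (auto simp: avoids_def)
    then have "crit (mu w) B {} (mu v)"
      using base_crit[OF v(1) wv, of b] anchors_le[OF v(1) wv] by auto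
    then show ?thesis using crit_not_mem mw by blast
  qed
  moreover have "A \<in> mu z" using G(2) by (simp add: z_def)
  ultimately show ?thesis using that z wz by blast
qed

lemma deficiency:
  assumes w: "valid w" and y: "valid y" and wy: "acc w y" and AB: "A \<^bold>\<rhd> B \<in> mu w"
    and A: "A \<in> mu y" "A \<in> D" and B: "B \<in> D"
  obtains z where "valid z" "srel w y z" "B \<in> mu z"
proof -
  have mw: "mcs (mu w)" and my: "mcs (mu y)" using w y valid_mcs by blast+
  have nA: "\<^bold>\<box> \<^bold>\<not> A \<notin> mu x" if "acc x y" for x
    using acc_prec[OF y that] A(1) my unfolding prec_def by auto
  \<comment> \<open>\<open>\<box>\<not>B\<close> will be the box that the new node gains over
    \<open>w\<close>, as validity demands.\<close>
  have nB: "\<^bold>\<box> \<^bold>\<not> B \<notin> mu w" using mcs_rhd_dia_box[OF mw AB] nA wy by blast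
  have AN: "\<^bold>\<box> \<^bold>\<not> A \<in> N" using A(2) by (simp add: N_def)
  have box: "insert (\<^bold>\<box> \<^bold>\<not> A) L \<subseteq> range Box" if "L \<subseteq> range Box" for L using that by auto
  have no_base: "\<not> base w b" if "b \<preceq> w" for b
    using base_acc[of w b w] acc_not_le[of w b] that by auto
  show ?thesis
  proof (cases "base w y")
    case True
    note vy = valid_base[OF y True]
    obtain G where G: "mcs G" "B \<in> G" "\<^bold>\<box> \<^bold>\<not> B \<in> G"
        "crit (mu w) (crt y) (insert (\<^bold>\<box> \<^bold>\<not> A) (lab y)) G"
      using crit_exists_W[OF mw vy(2) A(1) AB] by blast
    \<comment> \<open>A sibling of \<open>y\<close> with the same formula: anchors and avoided
      formulas stay, and the label only grows.\<close>
    define z where "z = Node (par y) w G (crt y) (insert (\<^bold>\<box> \<^bold>\<not> A) (lab y))"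
    have bz: "base w z" by (auto simp: z_def base_def)
    have LG: "insert (\<^bold>\<box> \<^bold>\<not> A) (lab y) \<subseteq> G" by (rule crit_subset[OF mw G(1,4)])
    have "boxes (mu (par y)) \<subseteq> G"
    proof (cases "par y = w")
      case True
      then show ?thesis using crit_prec[OF mw G(1,4)] by (auto simp: boxes_def prec_def)
    next
      case False
      then show ?thesis using valid_base_par(2)[OF y True] LG by blast
    qed
    then have z: "valid z"
      unfolding z_def using vy G nB B box[OF vy(3)] valid_base_par[OF y True] by auto
    have wz: "acc w z" using bz base_acc by simp
    have anchors: "anchors w y = anchors w z" using True bz by (auto simp: anchors_def z_def)
    moreover have "crt y = crt z" by (simp add: z_def)
    ultimately have "avoids w y \<subseteq> avoids w z" unfolding avoids_def using bz by blast
    moreover have "kept w y \<subseteq> kept w z" using True bz by (auto simp: kept_def z_def)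
    ultimately have "srel w y z" using anchors True wy wz unfolding srel_def by blast
    moreover have "B \<in> mu z" using G(2) by (simp add: z_def)
    ultimately show ?thesis using that z by blast
  next
    case False
    note Ty = anchors_not_base[OF wy False]
    show ?thesis
    proof (cases "anchors w y = {}")
      case True
      have "crit (mu w) \<^bold>\<bottom> {} (mu y)" using crit_Bot mw my acc_prec y wy by blast
      then obtain G where G: "mcs G" "B \<in> G" "\<^bold>\<box> \<^bold>\<not> B \<in> G"
          "crit (mu w) \<^bold>\<bottom> {\<^bold>\<box> \<^bold>\<not> A} G"
        using crit_exists_W[OF mw _ A(1) AB] by blast
      \<comment> \<open>Without anchors \<open>y\<close> passes on nothing; the label of
        \<open>z\<close> makes \<open>kept\<close> grow.\<close>
      define z where "z = Node w w G \<^bold>\<bottom> {\<^bold>\<box> \<^bold>\<not> A}"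
      have "boxes (mu w) \<subseteq> G"
        using crit_prec[OF mw G(1,4)] by (auto simp: boxes_def prec_def)
      then have z: "valid z"
        unfolding z_def using w G nB B no_base by auto
      have bz: "base w z" by (auto simp: z_def base_def)
      then have wz: "acc w z" using base_acc by simp
      have "kept w y = {}" "avoids w y = {}" using False True by (auto simp: kept_def avoids_def)
      moreover have "kept w z \<noteq> {}" using bz AN by (auto simp: kept_def z_def)
      ultimately have "srel w y z" using True wy wz unfolding srel_def by blast
      moreover have "B \<in> mu z" using G(2) by (simp add: z_def)
    ultimately show ?thesis using that z by blast
    next
      case nonempty: False
      then obtain x' where "x' \<preceq> pp y" "acc w x'" using False by (auto simp: anchors_def)
      then obtain x where x: "x \<preceq> pp y" "acc w x"
          and max: "\<And>u. u \<preceq> pp y \<Longrightarrow> acc w u \<Longrightarrow> u \<preceq> x"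
        using le_max[of x' "pp y" "acc w"] by blast
      have xy: "acc x y" using base_acc[OF acc_base[OF wy]] x by blast
      have vx: "valid x" using acc_le y xy by blast
      have mx: "mcs (mu x)" using valid_mcs vx by blast
      \<comment> \<open>\<open>E\<close> is the common formula of the bases over \<open>w\<close> up
        to \<open>x\<close>, or bottom if there are none.\<close>
      obtain E where E: "\<And>b. b \<preceq> x \<Longrightarrow> base w b \<Longrightarrow> crt b = E"
          "E = \<^bold>\<bottom> \<or> (\<exists>b. b \<preceq> x \<and> base w b \<and> crt b = E)"
        using base_crt_unique[OF vx] by metis
      have "crit (mu w) E {} (mu x)"
        using E(2) crit_Bot[OF mw mx acc_prec[OF vx x(2)]] base_crit[OF vx x(2)] by blast
      then obtain G where G: "mcs G" "B \<in> G" "\<^bold>\<box> \<^bold>\<not> B \<in> G"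
          "crit (mu w) E (insert (\<^bold>\<box> \<^bold>\<not> A) (boxes (mu x))) G"
        using crit_exists_M0[OF mw mx _ nA[OF xy] AB] by blast
      define z where "z = Node x w G E (insert (\<^bold>\<box> \<^bold>\<not> A) (boxes (mu x)))"
      have LG: "insert (\<^bold>\<box> \<^bold>\<not> A) (boxes (mu x)) \<subseteq> G" by (rule crit_subset[OF mw G(1,4)])
      have z: "valid z"
        unfolding z_def using vx G nB B E x(2) LG acc_le(2)[OF vx x(2)] by (auto simp: boxes_def)
      have bz: "base w z" by (auto simp: z_def base_def)
      then have wz: "acc w z" using base_acc by simp
      have anchors: "anchors w y \<subseteq> anchors w z" using False bz max by (auto simp: anchors_def z_def)
      have "avoids w y \<subseteq> avoids w z"
        using anchors False by (auto simp: avoids_def)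
      moreover have "kept w y \<subseteq> kept w z"
      proof -
        have "N \<inter> mu u \<subseteq> boxes (mu x)" if "u \<in> anchors w y" for u
          using that False max[of u] le_N[OF vx, of u] N_boxes by (auto simp: anchors_def)
        then show ?thesis using False bz by (auto simp: kept_def z_def)
      qed
      \<comment> \<open>Growth is strict: \<open>A\<close> holds at \<open>y\<close>, so no anchor
        of \<open>y\<close> contains \<open>\<box>\<not>A\<close>.\<close>
      moreover have "\<^bold>\<box> \<^bold>\<not> A \<in> kept w z" "\<^bold>\<box> \<^bold>\<not> A \<notin> kept w y"
        using False bz AN nA Ty by (auto simp: kept_def z_def)
      ultimately have "srel w y z" using anchors wy wz unfolding srel_def by blast
      moreover have "B \<in> mu z" using G(2) by (simp add: z_def)
    ultimately show ?thesis using that z by blast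
    qed
  qed
qed

section \<open>The frame conditions\<close>

lemma frame:
  assumes "W \<noteq> {}" "countable W" and W: "W \<subseteq> Collect valid"
  shows "ILW_star_frame W {(x, y). x \<in> W \<and> y \<in> W \<and> acc x y}
    (\<lambda>w. {(y, z). y \<in> W \<and> z \<in> W \<and> srel w y z})"
    (is "ILW_star_frame W ?acc ?srel")
proof
  have V: "valid x" if "x \<in> W" for x using that W by blast
  have fin: "finite N" using finite_D by (simp add: N_def)
  show "W \<noteq> {}" "countable W" by fact+
  show "?acc \<subseteq> W \<times> W" by auto
  show "conv_wf_on W ?acc"
  proof (rule conv_wf_on_measure[of "\<lambda>x. card (N \<inter> mu x)" "card N"])
    show "card (N \<inter> mu x) \<le> card N" for x using fin by (simp add: card_mono)
    fix a b c assume "(a, b) \<in> ?acc" "(b, c) \<in> ?acc"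
    then have "N \<inter> mu b \<subset> N \<inter> mu c" using acc_N V by blast
    then show "card (N \<inter> mu b) < card (N \<inter> mu c)" using fin by (simp add: psubset_card_mono)
  qed
  show "trans ?acc" using acc_trans V by (auto intro!: transI)
  show "(x, y) \<in> ?acc \<and> (x, z) \<in> ?acc" if "x \<in> W" "(y, z) \<in> ?srel x" for x y z
    using that by (auto simp: srel_def)
  show "(y, y) \<in> ?srel x" if "(x, y) \<in> ?acc" for x y
    using that by (auto simp: srel_def)
  show "(y, z) \<in> ?srel x" if "(x, y) \<in> ?acc" "(y, z) \<in> ?acc" for x y z
    using that acc_imp_srel V by blast
  show "trans (?srel x)" for x
    using srel_trans by (auto intro!: transI)
  show "(x, z) \<in> ?acc" if "(w, x) \<in> ?acc" "(x, y) \<in> ?acc" "(y, y') \<in> ?srel w" "(y', z) \<in> ?acc"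
    for w x y y' z
    using that srel_acc_M0 V by blast
  show "conv_wf_on W (?srel w O ?acc)" for w
  proof (rule conv_wf_on_measure[of "\<lambda>x. card (kept w x)" "card N"])
    show "card (kept w x) \<le> card N" for x using fin by (simp add: card_mono kept_def)
    fix a b c assume ab: "(a, b) \<in> ?srel w O ?acc" and bc: "(b, c) \<in> ?srel w O ?acc"
    obtain t where t: "srel w a t" "acc t b" "b \<in> W" using ab by blast
    obtain u where u: "srel w b u" "acc u c" "c \<in> W" using bc by blast
    have "acc w t" using t(1) unfolding srel_def by blast
    then have "\<not> base w b" using acc_not_base t(2) by blast
    then have "kept w b \<subset> kept w c" using srel_acc_kept V t u by blast
    moreover have "finite (kept w c)" using fin by (simp add: kept_def)
    ultimately show "card (kept w b) < card (kept w c)" by (rule psubset_card_mono[rotated])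
  qed
qed

end

section \<open>Countable submodel and truth lemma\<close>

text \<open>\<open>\<box>A\<close> is treated as \<open>\<not>A \<rhd> \<bottom>\<close>.\<close>

primrec sides :: "form \<Rightarrow> form set" where
  "sides (Var p) = {}"
| "sides \<^bold>\<bottom> = {}"
| "sides (A \<^bold>\<rightarrow> B) = sides A \<union> sides B"
| "sides (\<^bold>\<box> A) = insert (\<^bold>\<not> A) (sides A)"
| "sides (A \<^bold>\<rhd> B) = insert A (insert B (sides A \<union> sides B))"

lemma finite_sides: "finite (sides A)"
  by (induction A) auto

instance form :: countable
  by countable_datatype

text \<open>A Loewenheim-Skolem argument: chosen witnesses for all indices and pairs of points are
  added in countably many rounds.\<close>

lemma countable_closure:
  fixes P :: "'i :: countable \<Rightarrow> 'a \<Rightarrow> 'a \<Rightarrow> 'a \<Rightarrow> bool"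
  assumes a: "a \<in> X"
  obtains W where "countable W" "a \<in> W" "W \<subseteq> X"
    "\<And>i x y z. x \<in> W \<Longrightarrow> y \<in> W \<Longrightarrow> z \<in> X \<Longrightarrow> P i x y z \<Longrightarrow> \<exists>z \<in> W. P i x y z"
proof -
  \<comment> \<open>The default \<open>a\<close> keeps the values in \<open>X\<close> when no
    witness exists.\<close>
  define f where "f i x y = (if \<exists>z \<in> X. P i x y z then SOME z. z \<in> X \<and> P i x y z else a)" for i x y
  have f: "f i x y \<in> X" "\<And>z. z \<in> X \<Longrightarrow> P i x y z \<Longrightarrow> P i x y (f i x y)" for i x y
    using a someI_ex[of "\<lambda>z. z \<in> X \<and> P i x y z"] by (auto simp: f_def)
  define g where "g W = W \<union> (\<lambda>(i, x, y). f i x y) ` (UNIV \<times> W \<times> W)" for W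
  define W where "W n = (g ^^ n) {a}" for n
  have W0: "W 0 = {a}" and WS: "W (Suc n) = g (W n)" for n by (simp_all add: W_def)
  have cX: "countable (W n) \<and> W n \<subseteq> X" for n
    by (induction n) (use a f in \<open>auto simp: W0 WS g_def\<close>)
  have mono: "W m \<subseteq> W n" if "m \<le> n" for m n
    using that by (induction rule: dec_induct) (auto simp: WS g_def)
  show ?thesis
  proof (rule that[of "\<Union>n. W n"])
    show "countable (\<Union>n. W n)" "(\<Union>n. W n) \<subseteq> X" using cX by auto
    show "a \<in> (\<Union>n. W n)" using W0 by auto
    fix i x y z assume "x \<in> (\<Union>n. W n)" "y \<in> (\<Union>n. W n)" and z: "z \<in> X" "P i x y z"
    then obtain m n where "x \<in> W m" "y \<in> W n" by auto
    then have "x \<in> W (max m n)" "y \<in> W (max m n)"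
      using mono[of m "max m n"] mono[of n "max m n"] by auto
    then have "f i x y \<in> W (Suc (max m n))" by (force simp: WS g_def)
    then show "\<exists>z \<in> (\<Union>n. W n). P i x y z" using f(2)[OF z] by blast
  qed
qed

theorem theorem7p1:
  fixes \<phi> :: form
  assumes "\<And>(W :: nat set) R S V w. ILW_star_frame W R S \<Longrightarrow> w \<in> W \<Longrightarrow> forces R S V w \<phi>"
  shows "\<phi> \<in> ILW_star"
proof (rule thm_if_all_mcs)
  fix G assume G: "mcs G"
  interpret canonical "sides \<phi>" by unfold_locales (rule finite_sides)
  \<comment> \<open>One relation for both kinds of witness; for problems \<open>y\<close> is a
    dummy. As \<open>v\<close> ranges over all valid nodes, the property survives the restriction to
    \<open>W\<close>.\<close>
  define P where "P = (\<lambda>(A, B) w y z. if A \<^bold>\<rhd> B \<in> mu w then srel w y z \<and> B \<in> mu z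
    else acc w z \<and> A \<in> mu z \<and> (\<forall>v. valid v \<longrightarrow> srel w z v \<longrightarrow> B \<notin> mu v))"
  have "Root G \<in> Collect valid" using G by simp
  then obtain W where W: "countable W" "Root G \<in> W" "W \<subseteq> Collect valid"
    "\<And>i x y z. x \<in> W \<Longrightarrow> y \<in> W \<Longrightarrow> z \<in> Collect valid \<Longrightarrow> P i x y z \<Longrightarrow> \<exists>z \<in> W. P i x y z"
    using countable_closure[of "Root G" "Collect valid" P] by metis
  have V: "valid x" if "x \<in> W" for x using that W(3) by blast
  have M: "mcs (mu x)" if "x \<in> W" for x using V that valid_mcs by blast
  have prob: "\<exists>z\<in>W. acc w z \<and> A \<in> mu z \<and> (\<forall>v\<in>W. srel w z v \<longrightarrow> B \<notin> mu v)"
    if w: "w \<in> W" and AB: "A \<^bold>\<rhd> B \<notin> mu w" "A \<in> sides \<phi>" for w A B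
  proof -
    obtain z where "valid z" "P (A, B) w w z"
      using problem[OF V[OF w] AB] AB(1) unfolding P_def by auto
    then obtain z where "z \<in> W" "P (A, B) w w z" using W(4)[OF w w] by blast
    then show ?thesis using AB(1) V by (auto simp: P_def)
  qed
  have defic: "\<exists>z\<in>W. srel w y z \<and> B \<in> mu z"
    if wy: "w \<in> W" "y \<in> W" and AB: "acc w y" "A \<^bold>\<rhd> B \<in> mu w" "A \<in> mu y" "A \<in> sides \<phi>" "B \<in> sides \<phi>"
    for w y A B
  proof -
    obtain z where "valid z" "P (A, B) w y z"
      using deficiency[OF V[OF wy(1)] V[OF wy(2)] AB] AB(2) unfolding P_def by auto
    then obtain z where "z \<in> W" "P (A, B) w y z" using W(4)[OF wy] by blast
    then show ?thesis using AB(2) by (auto simp: P_def)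
  qed
  define R' where "R' = {(x, y). x \<in> W \<and> y \<in> W \<and> acc x y}"
  define S' where "S' = (\<lambda>w. {(y, z). y \<in> W \<and> z \<in> W \<and> srel w y z})"
  have RS: "(x, y) \<in> R' \<longleftrightarrow> x \<in> W \<and> y \<in> W \<and> acc x y"
    "(x, y) \<in> S' w \<longleftrightarrow> x \<in> W \<and> y \<in> W \<and> srel w x y" for w x y
    by (simp_all add: R'_def S'_def)
  define val where "val = (\<lambda>w p. Var p \<in> mu w)"
  have truth: "forces R' S' val w A \<longleftrightarrow> A \<in> mu w" if "sides A \<subseteq> sides \<phi>" "w \<in> W" for w A
    using that
  proof (induction A arbitrary: w)
    case (Var p)
    then show ?case by (simp add: val_def)
  next
    case Bot
    then show ?case using M by simp
  next
    case (Imp A B)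
    then show ?case using M by simp
  next
    case (Box A)
    have "A \<in> mu u" if "\<^bold>\<box> A \<in> mu w" "acc w u" "u \<in> W" for u
      using acc_prec[OF V[OF that(3)] that(2)] that(1) unfolding prec_def by blast
    moreover have "\<exists>u\<in>W. acc w u \<and> A \<notin> mu u" if "\<^bold>\<box> A \<notin> mu w"
    proof -
      have "\<^bold>\<not> A \<^bold>\<rhd> \<^bold>\<bottom> \<notin> mu w"
      proof
        assume "\<^bold>\<not> A \<^bold>\<rhd> \<^bold>\<bottom> \<in> mu w"
        then have *: "\<^bold>\<box> \<^bold>\<not> \<^bold>\<not> A \<in> mu w" using mcs_rhd_Bot M Box.prems(2) by blast
        have "\<^bold>\<box> A \<in> mu w" by (rule mcs_box_mono[OF M[OF Box.prems(2)] *]) auto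
        then show False using that by simp
      qed
      then obtain u where "u \<in> W" "acc w u" "\<^bold>\<not> A \<in> mu u"
        using prob[OF Box.prems(2)] Box.prems(1) by fastforce
      then show ?thesis using M by auto
    qed
    ultimately show ?case using Box by (auto simp: RS)
  next
    case (Rhd A B)
    have A: "A \<in> sides \<phi>" "B \<in> sides \<phi>" using Rhd.prems by auto
    have "(\<forall>u\<in>W. acc w u \<longrightarrow> A \<in> mu u \<longrightarrow> (\<exists>v\<in>W. srel w u v \<and> B \<in> mu v)) \<longleftrightarrow> A \<^bold>\<rhd> B \<in> mu w"
      using prob[OF Rhd.prems(2) _ A(1), of B] defic[OF Rhd.prems(2) _ _ _ _ A] by blast
    moreover have "forces R' S' val u A \<longleftrightarrow> A \<in> mu u" "forces R' S' val u B \<longleftrightarrow> B \<in> mu u"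
      if "u \<in> W" for u
      using Rhd that by simp_all
    ultimately show ?case using Rhd.prems(2) unfolding forces.simps RS by blast
  qed
  have "ILW_star_frame W R' S'" unfolding R'_def S'_def using frame W by blast
  \<comment> \<open>The worlds are nodes while the hypothesis concerns \<open>nat\<close>, so
    validity is transferred.\<close>
  moreover have "ILW_star_valid TYPE(node) \<phi>"
    by (rule ILW_star_valid_nat_imp) (use assms in \<open>auto simp: ILW_star_valid_def\<close>)
  ultimately have "forces R' S' val (Root G) \<phi>" using W(2) unfolding ILW_star_valid_def by blast
  then show "\<phi> \<in> G" using truth[of \<phi> "Root G"] W(2) by simp
qed

end
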